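(* Let $d\ge 1$ and let $V:\mathbb{R}^d\to[0,\infty)$ be a locally bounded (Borel measurable) potential that is confining, i.e. $V(x)\to\infty$ as $|x|\to\infty$. Let $\varphi_0$ be the ground state of the Schrödinger operator $H=-\Delta+V$ acting in $L^2(\mathbb{R}^d)$. Then the following hold. (I) For every $\varepsilon>0$ and $\delta\in(0,1)$ there exist $c,r>0$ such that $$\varphi_0(x)\ \ge\ c\,\exp\left(-(1+\varepsilon)\sqrt{V^{\delta}(x)}\,|x|\right),\qquad |x|\ge r,$$ where $V^{\delta}(x):=\sup_{z\in B_{|x|+\delta}(0)}V(z)$. (II) For every $\varepsilon,\delta\in(0,1)$ there exist $c,r>0$ such that $$\varphi_0(x)\ \le\ c\,\exp\left(-(1-\varepsilon)\,\delta\,\sqrt{V_{\delta}(x)}\,|x|\right),\qquad |x|\ge r,$$ where $V_{\delta}(x):=\inf_{z\in B_{\delta|x|}(x)}V(z)$.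
   Context: $\Delta$ is the classical Laplacian on $\mathbb{R}^d$ and $B_r(x)$ is the open ball of radius $r$ centred at $x$. $H=-\Delta+V$ is the nonnegative self-adjoint operator in $L^2(\mathbb{R}^d)$ defined in the usual (form) sense. The ground state $\varphi_0$ of $H$ is the eigenfunction, unique up to a multiplicative constant, corresponding to the eigenvalue $\lambda_0:=\inf\sigma(H)>0$; it is taken in its bounded, continuous and strictly positive version on $\mathbb{R}^d$ (e.g. normalized in $L^2$), so that $e^{-\lambda_0 t}\varphi_0(x)=e^{-tH}\varphi_0(x)$ for all $x\in\mathbb{R}^d$, $t>0$. *)

theory Defs
  imports "HOL-Analysis.Analysis"
begin

text \<open>Elements of \<open>L\<^sup>2\<close> are represented by complex-valued Borel functions; equality in \<open>L\<^sup>2\<close> is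
  equality almost everywhere.\<close>

definition L2_fun :: "('a::euclidean_space \<Rightarrow> complex) set" where
  "L2_fun = {f. f \<in> borel_measurable borel \<and> integrable lborel (\<lambda>x. (cmod (f x))\<^sup>2)}"

definition L2_inner :: "('a::euclidean_space \<Rightarrow> complex) \<Rightarrow> ('a \<Rightarrow> complex) \<Rightarrow> complex" where
  "L2_inner f g = (LINT x|lborel. f x * cnj (g x))"

definition L2_norm :: "('a::euclidean_space \<Rightarrow> complex) \<Rightarrow> real" where
  "L2_norm f = sqrt (LINT x|lborel. (cmod (f x))\<^sup>2)"

primrec C_diff :: "nat \<Rightarrow> ('a::euclidean_space \<Rightarrow> real) \<Rightarrow> bool" where
  "C_diff 0 f \<longleftrightarrow> continuous_on UNIV f"
| "C_diff (Suc k) f \<longleftrightarrow> (\<forall>x. f differentiable (at x)) \<and>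
     (\<forall>b\<in>Basis. C_diff k (\<lambda>x. frechet_derivative f (at x) b))"

definition test_function :: "('a::euclidean_space \<Rightarrow> real) \<Rightarrow> bool" where
  "test_function \<psi> \<longleftrightarrow> (\<forall>k. C_diff k \<psi>) \<and> compact (closure {x. \<psi> x \<noteq> 0})"

definition has_weak_partial ::
  "('a::euclidean_space \<Rightarrow> complex) \<Rightarrow> 'a \<Rightarrow> ('a \<Rightarrow> complex) \<Rightarrow> bool" where
  "has_weak_partial u b g \<longleftrightarrow> u \<in> L2_fun \<and> g \<in> L2_fun \<and>
     (\<forall>\<psi>. test_function \<psi> \<longrightarrow>
        (LINT x|lborel. frechet_derivative \<psi> (at x) b *\<^sub>R u x) = - (LINT x|lborel. \<psi> x *\<^sub>R g x))"

text \<open>Weak derivatives are unique only almost everywhere; any representative will do.\<close>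

definition weak_partial :: "'a::euclidean_space \<Rightarrow> ('a \<Rightarrow> complex) \<Rightarrow> 'a \<Rightarrow> complex" where
  "weak_partial b u = (SOME g. has_weak_partial u b g)"

text \<open>The form sum of \<open>-\<Delta>\<close> and \<open>V\<close>: its domain consists of the \<open>u \<in> H\<^sup>1\<close> with
  \<open>\<integral> V |u|\<^sup>2 < \<infinity>\<close>.\<close>

definition form_domain :: "('a::euclidean_space \<Rightarrow> real) \<Rightarrow> ('a \<Rightarrow> complex) set" where
  "form_domain V = {u \<in> L2_fun. (\<forall>b\<in>Basis. \<exists>g. has_weak_partial u b g) \<and>
     integrable lborel (\<lambda>x. V x * (cmod (u x))\<^sup>2)}"

definition schrodinger_form ::
  "('a::euclidean_space \<Rightarrow> real) \<Rightarrow> ('a \<Rightarrow> complex) \<Rightarrow> ('a \<Rightarrow> complex) \<Rightarrow> complex" where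
  "schrodinger_form V u v =
     (\<Sum>b\<in>Basis. L2_inner (weak_partial b u) (weak_partial b v)) +
     (LINT x|lborel. complex_of_real (V x) * u x * cnj (v x))"

text \<open>The graph of the self-adjoint operator associated with the form: \<open>(u, f)\<close> belongs to it iff
  \<open>u\<close> is in the operator domain and \<open>H u = f\<close>.\<close>

definition schrodinger_op ::
  "('a::euclidean_space \<Rightarrow> real) \<Rightarrow> (('a \<Rightarrow> complex) \<times> ('a \<Rightarrow> complex)) set" where
  "schrodinger_op V = {(u, f). u \<in> form_domain V \<and> f \<in> L2_fun \<and>
     (\<forall>v\<in>form_domain V. schrodinger_form V u v = L2_inner f v)}"

text \<open>For an operator given by its graph \<open>T\<close>: \<open>z\<close> is in the resolvent set iff \<open>T - z\<close> maps the domain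
  onto \<open>L\<^sup>2\<close> and is injective with bounded inverse; the last two properties are the norm estimate.\<close>

definition resolvent_set ::
  "(('a::euclidean_space \<Rightarrow> complex) \<times> ('a \<Rightarrow> complex)) set \<Rightarrow> complex set" where
  "resolvent_set T = {z.
     (\<forall>f\<in>L2_fun. \<exists>(u, g)\<in>T. AE x in lborel. g x - z * u x = f x) \<and>
     (\<exists>C. \<forall>(u, g)\<in>T. L2_norm u \<le> C * L2_norm (\<lambda>x. g x - z * u x))}"

definition op_spectrum ::
  "(('a::euclidean_space \<Rightarrow> complex) \<times> ('a \<Rightarrow> complex)) set \<Rightarrow> complex set" where
  "op_spectrum T = - resolvent_set T"

definition ground_energy :: "('a::euclidean_space \<Rightarrow> real) \<Rightarrow> real" where
  "ground_energy V = Inf {l. complex_of_real l \<in> op_spectrum (schrodinger_op V)}"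

text \<open>The ground state in its bounded, continuous, strictly positive version. It is determined only
  up to a positive constant factor, as no normalization is imposed.\<close>

definition ground_state :: "('a::euclidean_space \<Rightarrow> real) \<Rightarrow> ('a \<Rightarrow> real) \<Rightarrow> bool" where
  "ground_state V \<phi> \<longleftrightarrow>
     ((\<lambda>x. complex_of_real (\<phi> x)), (\<lambda>x. complex_of_real (ground_energy V * \<phi> x)))
       \<in> schrodinger_op V \<and>
     continuous_on UNIV \<phi> \<and> bounded (range \<phi>) \<and> (\<forall>x. 0 < \<phi> x)"

definition locally_bounded :: "('a::euclidean_space \<Rightarrow> real) \<Rightarrow> bool" where
  "locally_bounded V \<longleftrightarrow> (\<forall>K. compact K \<longrightarrow> bounded (V ` K))"

definition confining :: "('a::euclidean_space \<Rightarrow> real) \<Rightarrow> bool" where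
  "confining V \<longleftrightarrow> filterlim V at_top at_infinity"

definition V_upper :: "('a::euclidean_space \<Rightarrow> real) \<Rightarrow> real \<Rightarrow> 'a \<Rightarrow> real" where
  "V_upper V \<delta> x = (SUP z\<in>ball 0 (norm x + \<delta>). V z)"

definition V_lower :: "('a::euclidean_space \<Rightarrow> real) \<Rightarrow> real \<Rightarrow> 'a \<Rightarrow> real" where
  "V_lower V \<delta> x = (INF z\<in>ball x (\<delta> * norm x). V z)"

end

theory Submission imports Defs begin

text \<open>Testing the eigenvalue equation with test functions gives
  \<open>\<integral> \<phi> \<Delta>\<psi> = \<integral> (V - \<lambda>\<^sub>0) \<phi> \<psi>\<close>. On a region where \<open>V - \<lambda>\<^sub>0\<close> is bounded below (above) by a constant
  \<open>k > 0\<close>, the positive function \<open>\<phi>\<close> is therefore a weak subsolution (supersolution) of \<open>\<Delta>u = k u\<close>, and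
  it is compared there with an explicit radial exponential: for the upper bound on \<open>B\<^bsub>\<delta>|x|\<^esub>(x)\<close>
  with \<open>exp (a \<surd>(1 + |y - x|\<^sup>2))\<close>, for the lower bound on the annulus \<open>1 < |y| < |x| + \<delta>\<close>
  with \<open>exp (- a |y|) - exp (- a (|x| + \<delta>))\<close>, where \<open>a\<close> is \<open>\<surd>V\<^sub>\<delta>(x)\<close> (respectively \<open>\<surd>V\<^sup>\<delta>(x)\<close>) up
  to a factor close to \<open>1\<close>. As \<open>V\<close> is confining, \<open>\<lambda>\<^sub>0\<close> and the first-order terms of the Laplacian of
  the exponential are absorbed by that factor.\<close>

section \<open>Smooth compactly supported functions\<close>

text \<open>As \<open>V\<close> is only measurable and locally bounded, no classical second
  derivatives of \<open>\<phi>\<close> are available, and a maximum principle cannot be applied to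
  it pointwise. Mollifying the equation with \<open>V\<close> inside would blur the coefficient too;
  once \<open>V - \<lambda>\<^sub>0\<close> is replaced by a constant on the region, the inequality
  is compatible with translations, hence with mollification. The barrier stays as it is: of it only
  limits of symmetric second differences are required, which is what a maximum controls.

  The barriers differ because their domains do. The ball contains its centre, where |y - x| is not
  smooth; the regularised root cures this at the cost of a factor exp(a). The annulus avoids the
  origin, so |y| itself serves. The lower barrier is shifted to vanish on the outer sphere, where
  only positivity of \<open>\<phi>\<close> is at hand. That sphere lies \<delta> beyond |x|, which
  leaves at x the factor 1 - exp(-a \<delta>), at least 1/2 once a \<delta> \<ge> 1. The factor
  \<delta> in the upper exponent is the radius of the ball relative to |x|.\<close>

definition flat :: "real poly \<Rightarrow> real \<Rightarrow> real" where
  "flat p t = (if 0 < t then poly p (1 / t) * exp (- 1 / t) else 0)"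

text \<open>With s = 1/t, the t-derivative of p(s) exp(-s) is s^2 (p(s) - p'(s)) exp(-s).
  Differentiation thus stays inside the family \<open>flat p\<close>, and smoothness of every order
  follows by induction with \<open>p\<close> arbitrary.\<close>

definition flat_D :: "real poly \<Rightarrow> real poly" where
  "flat_D p = [:0, 0, 1:] * (p - pderiv p)"

lemma poly_times_exp_minus_tendsto_0: "((\<lambda>s. poly p s * exp (- s)) \<longlongrightarrow> (0::real)) at_top"
proof -
  have "((\<lambda>s. \<Sum>i\<le>degree p. coeff p i * (s ^ i / exp s)) \<longlongrightarrow> (\<Sum>i\<le>degree p. coeff p i * 0)) at_top"
    by (intro tendsto_intros tendsto_power_div_exp_0)
  then show ?thesis
    by (simp add: poly_altdef exp_minus sum_distrib_right divide_inverse mult.assoc)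
qed

lemma flat_DERIV: "(flat p has_real_derivative flat (flat_D p) t) (at t)"
proof -
  consider "t < 0" | "t = 0" | "0 < t" by linarith
  then show ?thesis
  proof cases
    case 1
    have "((\<lambda>_. 0) has_real_derivative 0) (at t)" by simp
    then have "(flat p has_real_derivative 0) (at t)"
      by (rule has_field_derivative_transform_within_open[of _ _ _ "{..<0}"])
        (use 1 in \<open>auto simp: flat_def\<close>)
    then show ?thesis using 1 by (simp add: flat_def)
  next
    case 3
    have "((\<lambda>t. poly p (1 / t) * exp (- 1 / t)) has_real_derivative flat (flat_D p) t) (at t)"
      using 3 by (auto intro!: derivative_eq_intros poly_DERIV DERIV_chain'[where g = "poly p"]
          simp: flat_def flat_D_def field_simps power2_eq_square)
    then show ?thesis
      by (rule has_field_derivative_transform_within_open[of _ _ _ "{0<..}"])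
        (use 3 in \<open>auto simp: flat_def\<close>)
  next
    case 2
    have "((\<lambda>h. flat p h / h) \<longlongrightarrow> 0) (at_right 0)"
    proof -
      have "filterlim (\<lambda>h::real. inverse h) at_top (at_right 0)"
        by (rule filterlim_inverse_at_top_right)
      \<comment> \<open>Under s = 1/h the difference quotient at 0 becomes s p(s) exp(-s);
        \<open>pCons 0 p\<close> carries the extra factor s.\<close>
      from filterlim_compose[OF poly_times_exp_minus_tendsto_0[of "pCons 0 p"] this]
      show ?thesis
        by (rule tendsto_cong[THEN iffD1, rotated])
          (auto simp: flat_def eventually_at_filter field_simps)
    qed
    moreover have "((\<lambda>h. flat p h / h) \<longlongrightarrow> 0) (at_left 0)"
      by (rule tendsto_cong[THEN iffD1, OF _ tendsto_const])
        (auto simp: flat_def eventually_at_filter)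
    ultimately have "((\<lambda>h. flat p h / h) \<longlongrightarrow> 0) (at 0)"
      by (simp add: filterlim_split_at)
    then show ?thesis using 2
      by (simp add: DERIV_def flat_def)
  qed
qed

section \<open>Closure properties of the classes of k times continuously differentiable
  functions\<close>

lemma C_diff_imp_continuous: "C_diff k f \<Longrightarrow> continuous_on UNIV f"
  by (cases k) (auto intro: continuous_at_imp_continuous_on differentiable_imp_continuous_within)

lemma C_diff_SucD: "C_diff (Suc k) f \<Longrightarrow> C_diff k f"
proof (induction k arbitrary: f)
  case 0
  then show ?case using C_diff_imp_continuous[of "Suc 0" f] by simp
next
  case (Suc k)
  show ?case using Suc.prems Suc.IH unfolding C_diff.simps(2)[of "Suc k"] C_diff.simps(2)[of k]
    by blast
qed

lemma C_diff_const: "C_diff k (\<lambda>_::'a::euclidean_space. c)"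
  by (induction k arbitrary: c) (simp_all add: frechet_derivative_const)

lemma C_diff_add:
  assumes "C_diff k f" "C_diff k g"
  shows "C_diff k (\<lambda>x. f x + g x)"
  using assms
proof (induction k arbitrary: f g)
  case 0
  then show ?case by (simp add: continuous_on_add)
next
  case (Suc k)
  then have "frechet_derivative (\<lambda>x. f x + g x) (at x) =
      (\<lambda>b. frechet_derivative f (at x) b + frechet_derivative g (at x) b)" for x
    by (intro frechet_derivative_at[symmetric] has_derivative_add)
      (simp_all add: frechet_derivative_works[symmetric])
  then show ?case using Suc by simp
qed

lemma C_diff_mult:
  assumes "C_diff k f" "C_diff k g"
  shows "C_diff k (\<lambda>x. f x * g x)"
  using assms
proof (induction k arbitrary: f g)
  case 0
  then show ?case by (simp add: continuous_on_mult)
next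
  case (Suc k)
  then have D: "frechet_derivative (\<lambda>x. f x * g x) (at x) =
      (\<lambda>b. f x * frechet_derivative g (at x) b + frechet_derivative f (at x) b * g x)" for x
    by (intro frechet_derivative_at[symmetric] has_derivative_mult)
      (simp_all add: frechet_derivative_works[symmetric])
  \<comment> \<open>The product rule leaves one factor undifferentiated in each term; it is needed
    at the lower order.\<close>
  have "C_diff k f" "C_diff k g" using Suc.prems by (blast intro: C_diff_SucD)+
  then show ?case using Suc by (simp add: D C_diff_add)
qed

lemma C_diff_prod:
  assumes "finite I" "\<And>i. i \<in> I \<Longrightarrow> C_diff k (f i)"
  shows "C_diff k (\<lambda>x. \<Prod>i\<in>I. f i x)"
  using assms by (induction I rule: finite_induct) (simp_all add: C_diff_const C_diff_mult)

lemma C_diff_translate: "C_diff k f \<Longrightarrow> C_diff k (\<lambda>x. f (x - p))"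
proof (induction k arbitrary: f)
  case 0
  then have "continuous_on ((\<lambda>x. x - p) ` UNIV) f" by (auto intro: continuous_on_subset)
  then have "continuous_on UNIV (f \<circ> (\<lambda>x. x - p))"
    by (intro continuous_on_compose continuous_intros)
  then show ?case by (simp add: o_def)
next
  case (Suc k)
  have D: "((\<lambda>x. f (x - p)) has_derivative frechet_derivative f (at (x - p))) (at x)" for x
  proof -
    have "((\<lambda>x. x - p) has_derivative (\<lambda>x. x)) (at x)"
      by (auto intro!: derivative_eq_intros)
    from has_derivative_compose[OF this, of f "frechet_derivative f (at (x - p))"] Suc.prems
    show ?thesis by (simp add: frechet_derivative_works[symmetric])
  qed
  then have "frechet_derivative (\<lambda>x. f (x - p)) (at x) = frechet_derivative f (at (x - p))" for x
    by (rule frechet_derivative_at[symmetric])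
  with Suc.prems D Suc.IH[of "\<lambda>x. frechet_derivative f (at x) b" for b] show ?case
    by (auto intro: differentiableI)
qed

lemma C_diff_flat: "C_diff k (\<lambda>x. flat p (s * (x \<bullet> b) + r))"
proof (induction k arbitrary: p)
  case 0
  have "continuous_on S (flat p)" for S
    by (rule DERIV_continuous_on[OF has_field_derivative_at_within[OF flat_DERIV]])
  then have "continuous_on UNIV (flat p \<circ> (\<lambda>x::'a. s * (x \<bullet> b) + r))"
    by (intro continuous_on_compose continuous_intros)
  then show ?case by (simp add: o_def)
next
  case (Suc k)
  have D: "((\<lambda>x. flat p (s * (x \<bullet> b) + r)) has_derivative
      (\<lambda>h. flat (flat_D p) (s * (x \<bullet> b) + r) * (s * (h \<bullet> b)))) (at x)" for x :: 'a
  proof -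
    have "((\<lambda>x. s * (x \<bullet> b) + r) has_derivative (\<lambda>h. s * (h \<bullet> b))) (at x)"
      by (auto intro!: derivative_eq_intros)
    from has_derivative_compose[OF this flat_DERIV[unfolded has_field_derivative_def]]
    show ?thesis .
  qed
  then have "frechet_derivative (\<lambda>x. flat p (s * (x \<bullet> b) + r)) (at x) =
      (\<lambda>h. flat (flat_D p) (s * (x \<bullet> b) + r) * (s * (h \<bullet> b)))" for x :: 'a
    by (rule frechet_derivative_at[symmetric])
  with Suc D show ?case by (auto intro: differentiableI C_diff_mult C_diff_const)
qed

section \<open>Smooth bumps supported on boxes\<close>

text \<open>\<open>flat 1 t\<close> is exp(-1/t) for positive t and 0 otherwise, so for positive
  \<open>s\<close> the product is positive exactly on the open box. The scale \<open>s\<close> is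
  there to be sent to infinity: inside the box every factor then tends to 1.\<close>

definition box_bump :: "real \<Rightarrow> 'a \<Rightarrow> 'a \<Rightarrow> 'a::euclidean_space \<Rightarrow> real" where
  "box_bump s l u x =
     (\<Prod>b\<in>Basis. flat 1 (s * ((x - l) \<bullet> b)) * flat 1 (s * ((u - x) \<bullet> b)))"

lemma flat_1: "0 \<le> flat 1 t" "flat 1 t \<le> 1" "flat 1 t = 0 \<longleftrightarrow> t \<le> 0"
  by (auto simp: flat_def)

lemma box_bump_nonneg: "0 \<le> box_bump s l u x"
  unfolding box_bump_def by (intro prod_nonneg) (simp add: flat_1)

lemma box_bump_le_1: "box_bump s l u x \<le> 1"
  unfolding box_bump_def by (intro prod_le_1) (simp add: flat_1 mult_le_one)

lemma box_bump_eq_0_iff: "0 < s \<Longrightarrow> box_bump s l u x = 0 \<longleftrightarrow> x \<notin> box l u"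
  unfolding box_bump_def
  by (auto simp: flat_1 mem_box inner_diff_left mult_le_0_iff not_less not_le)

lemma test_function_box_bump:
  assumes "0 < s"
  shows "test_function (box_bump s l (u::'a::euclidean_space))"
proof -
  have eq: "s * ((x - l) \<bullet> b) = s * (x \<bullet> b) + - s * (l \<bullet> b)"
     "s * ((u - x) \<bullet> b) = (- s) * (x \<bullet> b) + s * (u \<bullet> b)" for x b :: 'a
    by (simp_all add: inner_diff_left algebra_simps)
  have "C_diff k (box_bump s l u)" for k
    unfolding box_bump_def[abs_def] eq by (intro C_diff_prod C_diff_mult C_diff_flat) simp
  moreover have "{x. box_bump s l u x \<noteq> 0} = box l u"
    using assms by (auto simp: box_bump_eq_0_iff)
  then have "compact (closure {x. box_bump s l u x \<noteq> 0})"
    by (simp add: bounded_box)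
  ultimately show ?thesis by (simp add: test_function_def)
qed

lemma box_bump_tendsto:
  "(\<lambda>n. box_bump (real n) l u x) \<longlonglongrightarrow> indicat_real (box l (u::'a::euclidean_space)) x"
proof -
  have *: "(\<lambda>n. flat 1 (real n * t)) \<longlonglongrightarrow> (if 0 < t then 1 else 0)" for t
  proof (cases "0 < t")
    case True
    have "(\<lambda>n. exp (- (1 / t) * inverse (real n))) \<longlonglongrightarrow> exp (- (1 / t) * 0)"
      by (intro tendsto_intros tendsto_inverse_0_at_top filterlim_real_sequentially)
    then have "(\<lambda>n. flat 1 (real n * t)) \<longlonglongrightarrow> 1"
      using True
      by (auto elim!: Lim_transform_eventually
          simp: eventually_sequentially flat_def field_simps intro!: exI[of _ 1])
    with True show ?thesis by simp
  next
    case False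
    then have "flat 1 (real n * t) = 0" for n by (simp add: flat_1 mult_nonneg_nonpos)
    with False show ?thesis by simp
  qed
  have "(\<lambda>n. box_bump (real n) l u x) \<longlonglongrightarrow>
     (\<Prod>b\<in>Basis. (if 0 < (x - l) \<bullet> b then 1 else 0) * (if 0 < (u - x) \<bullet> b then 1 else 0))"
    unfolding box_bump_def by (intro tendsto_intros *)
  also have "(\<Prod>b\<in>Basis. (if 0 < (x - l) \<bullet> b then 1 else 0) * (if 0 < (u - x) \<bullet> b then 1 else 0))
      = indicat_real (box l u) x"
    by (auto simp: mem_box indicator_def inner_diff_left intro!: prod.neutral)
  finally show ?thesis .
qed

section \<open>Partial derivatives of test functions and integration by parts\<close>

definition pd :: "'a \<Rightarrow> ('a::euclidean_space \<Rightarrow> real) \<Rightarrow> 'a \<Rightarrow> real" where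
  "pd b \<psi> x = frechet_derivative \<psi> (at x) b"

definition laplacian :: "('a::euclidean_space \<Rightarrow> real) \<Rightarrow> 'a \<Rightarrow> real" where
  "laplacian \<psi> x = (\<Sum>b\<in>Basis. pd b (pd b \<psi>) x)"

lemma test_function_differentiable: "test_function \<psi> \<Longrightarrow> \<psi> differentiable (at x)"
  unfolding test_function_def by (metis C_diff.simps(2))

lemma test_function_continuous: "test_function \<psi> \<Longrightarrow> continuous_on S \<psi>"
  unfolding test_function_def by (metis C_diff.simps(1) continuous_on_subset subset_UNIV)

lemma test_function_borel [measurable_dest]: "test_function \<psi> \<Longrightarrow> \<psi> \<in> borel_measurable borel"
  by (simp add: borel_measurable_continuous_onI test_function_continuous)

lemma compact_closure_subset:
  "compact (closure T) \<Longrightarrow> S \<subseteq> closure T \<Longrightarrow> compact (closure (S :: 'a::euclidean_space set))"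
  by (meson bounded_closure bounded_subset closure_minimal closed_closure compact_closure compact_eq_bounded_closed)

lemma test_function_pd:
  assumes "test_function \<psi>" "b \<in> Basis"
  shows "test_function (pd b \<psi>)"
proof -
  have "C_diff k (pd b \<psi>)" for k
  proof -
    have "C_diff (Suc k) \<psi>" using assms(1) unfolding test_function_def by blast
    then show ?thesis using assms(2) by (simp add: pd_def[abs_def])
  qed
  moreover have "{x. pd b \<psi> x \<noteq> 0} \<subseteq> closure {x. \<psi> x \<noteq> 0}"
  proof (rule subsetI, rule ccontr)
    fix x assume x: "x \<in> {x. pd b \<psi> x \<noteq> 0}" "x \<notin> closure {x. \<psi> x \<noteq> 0}"
    have "(\<psi> has_derivative (\<lambda>_. 0)) (at x)"
      by (rule has_derivative_transform_within_open[of "\<lambda>_. 0" _ _ UNIV "- closure {x. \<psi> x \<noteq> 0}"])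
        (use x closure_subset[of "{x. \<psi> x \<noteq> 0}"] in auto)
    then have "frechet_derivative \<psi> (at x) = (\<lambda>_. 0)"
      by (rule frechet_derivative_at[symmetric])
    with x show False by (simp add: pd_def)
  qed
  with assms(1) have "compact (closure {x. pd b \<psi> x \<noteq> 0})"
    unfolding test_function_def by (metis compact_closure_subset)
  ultimately show ?thesis by (simp add: test_function_def)
qed

lemma test_function_mult:
  assumes "test_function \<psi>" "test_function \<theta>"
  shows "test_function (\<lambda>x. \<psi> x * \<theta> x)"
proof -
  have "{x. \<psi> x * \<theta> x \<noteq> 0} \<subseteq> closure {x. \<psi> x \<noteq> 0}"
    using closure_subset by fastforce
  with assms show ?thesis
    unfolding test_function_def by (blast intro: C_diff_mult compact_closure_subset)
qed

lemma test_function_translate: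
  assumes "test_function \<psi>"
  shows "test_function (\<lambda>x. \<psi> (x - p))"
proof -
  have "{x. \<psi> (x - p) \<noteq> 0} = (+) p ` {x. \<psi> x \<noteq> 0}"
    by (auto simp: image_iff) (metis add.commute diff_add_cancel)
  then have "closure {x. \<psi> (x - p) \<noteq> 0} = (+) p ` closure {x. \<psi> x \<noteq> 0}"
    by (simp add: closure_translation)
  with assms show ?thesis
    by (simp add: test_function_def C_diff_translate compact_translation)
qed

lemma test_function_bounds:
  assumes "test_function \<psi>"
  obtains C R where "0 \<le> C" "\<And>x. \<bar>\<psi> x\<bar> \<le> C" "\<And>x. R < norm x \<Longrightarrow> \<psi> x = 0"
proof -
  let ?S = "closure {x. \<psi> x \<noteq> 0}"
  have c: "compact ?S" using assms by (simp add: test_function_def)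
  then obtain R where R: "\<And>x. x \<in> ?S \<Longrightarrow> norm x \<le> R"
    by (meson bounded_iff compact_imp_bounded)
  have "bounded (\<psi> ` ?S)"
    using c assms by (intro compact_imp_bounded compact_continuous_image test_function_continuous)
  then obtain C where C: "0 < C" "\<And>x. x \<in> ?S \<Longrightarrow> \<bar>\<psi> x\<bar> \<le> C"
    by (auto simp: bounded_pos)
  have *: "\<psi> x = 0" if "x \<notin> ?S" for x
    using that closure_subset[of "{x. \<psi> x \<noteq> 0}"] by auto
  show thesis
  proof
    show "0 \<le> C" using C by simp
    show "\<bar>\<psi> x\<bar> \<le> C" for x using C[of] *[of x] by (cases "x \<in> ?S") auto
    show "\<psi> x = 0" if "R < norm x" for x using R[of x] *[of x] that by fastforce
  qed
qed

lemma integrable_bounded_support: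
  fixes f :: "'a::euclidean_space \<Rightarrow> 'b::{banach, second_countable_topology}"
  assumes "f \<in> borel_measurable borel" "\<And>x. norm x \<le> R \<Longrightarrow> norm (f x) \<le> C"
    and "\<And>x. R < norm x \<Longrightarrow> f x = 0"
  shows "integrable lborel f"
proof (rule Bochner_Integration.integrable_bound)
  show "integrable lborel (\<lambda>x. C * indicat_real (cball (0::'a) R) x)"
    by (intro integrable_mult_right integrable_real_indicator) (use emeasure_bounded_finite[OF bounded_cball] in auto)
  show "AE x in lborel. norm (f x) \<le> norm (C * indicat_real (cball (0::'a) R) x)"
    using assms(2,3) by (intro AE_I2) (fastforce simp: indicator_def not_le)
qed (use assms in simp)

lemma integrable_test_function_mult:
  fixes f :: "'a::euclidean_space \<Rightarrow> real"
  assumes "test_function \<psi>" "f \<in> borel_measurable borel" "\<And>R. bounded (f ` cball 0 R)"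
  shows "integrable lborel (\<lambda>x. \<psi> x * f x)"
proof -
  obtain C R where C: "0 \<le> C" "\<And>x. \<bar>\<psi> x\<bar> \<le> C" "\<And>x. R < norm x \<Longrightarrow> \<psi> x = 0"
    by (rule test_function_bounds[OF assms(1)]) blast
  obtain D where D: "\<And>x. norm x \<le> R \<Longrightarrow> \<bar>f x\<bar> \<le> D"
    using assms(3)[of R] by (fastforce simp: bounded_iff)
  show ?thesis
  proof (rule integrable_bounded_support[where R=R and C="C * D"])
    show "norm (\<psi> x * f x) \<le> C * D" if "norm x \<le> R" for x
      using C(1) C(2)[of x] D[OF that] by (auto simp: abs_mult intro!: mult_mono)
  qed (use assms C in \<open>auto intro: test_function_borel\<close>)
qed

lemma integrable_test_function: "test_function \<psi> \<Longrightarrow> integrable lborel \<psi>"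
  using integrable_test_function_mult[of \<psi> "\<lambda>_. 1"] by (simp add: image_constant_conv)

lemma pd_DERIV:
  assumes "test_function \<psi>"
  shows "((\<lambda>t. \<psi> (x + t *\<^sub>R b)) has_real_derivative pd b \<psi> (x + t *\<^sub>R b)) (at t)"
proof -
  let ?D = "frechet_derivative \<psi> (at (x + t *\<^sub>R b))"
  have D: "(\<psi> has_derivative ?D) (at (x + t *\<^sub>R b))"
    using test_function_differentiable[OF assms] by (simp add: frechet_derivative_works)
  have "((\<lambda>t. x + t *\<^sub>R b) has_derivative (\<lambda>h. h *\<^sub>R b)) (at t)"
    by (auto intro!: derivative_eq_intros)
  from has_derivative_compose[OF this D] show ?thesis
    using linear_scale[OF has_derivative_linear[OF D]]
    by (simp add: has_field_derivative_def pd_def mult.commute[of _ "?D b"])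
qed

lemma test_function_Lipschitz:
  assumes "test_function \<psi>" "\<And>x. \<bar>pd b \<psi> x\<bar> \<le> C"
  shows "\<bar>\<psi> (x + t *\<^sub>R b) - \<psi> x\<bar> \<le> C * \<bar>t\<bar>"
  using field_differentiable_bound[of UNIV "\<lambda>t. \<psi> (x + t *\<^sub>R b)" "\<lambda>t. pd b \<psi> (x + t *\<^sub>R b)" C 0 t]
    pd_DERIV[OF assms(1), of x b] assms(2) by (simp add: dist_norm)

lemma integral_translate:
  fixes f :: "'a::euclidean_space \<Rightarrow> 'b::{banach, second_countable_topology}"
  assumes "f \<in> borel_measurable borel"
  shows "(LINT x|lborel. f (x + a)) = (LINT x|lborel. f x)"
proof -
  have "(LINT x|lborel. f x) = (LINT x|distr lborel borel ((+) a). f x)"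
    by (simp add: lborel_distr_plus)
  also have "\<dots> = (LINT x|lborel. f (a + x))"
    using assms by (subst integral_distr) auto
  finally show ?thesis by (simp add: add.commute)
qed

text \<open>By translation invariance of Lebesgue measure every difference quotient of
  \<open>\<psi>\<close> has integral 0; the quotients converge to \<open>pd b \<psi>\<close> and are
  dominated through a Lipschitz bound on a fixed ball.\<close>

lemma integral_pd_eq_0:
  assumes \<psi>: "test_function \<psi>" and b: "b \<in> Basis"
  shows "(LINT x|lborel. pd b \<psi> x) = 0"
proof -
  obtain C R where C: "0 \<le> C" "\<And>x. \<bar>pd b \<psi> x\<bar> \<le> C"
    by (rule test_function_bounds[OF test_function_pd[OF assms]]) blast
  obtain C' R where R: "\<And>x. R < norm x \<Longrightarrow> \<psi> x = 0"
    by (rule test_function_bounds[OF \<psi>]) blast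
  define t where "t n = inverse (real (Suc n))" for n
  have t: "0 < t n" "t n \<le> 1" for n by (auto simp: t_def field_simps)
  define q where "q n x = (\<psi> (x + t n *\<^sub>R b) - \<psi> x) / t n" for n x
  have [measurable]: "\<psi> \<in> borel_measurable borel" using \<psi> by simp
  have tq: "filterlim t (at 0) sequentially"
    unfolding t_def[abs_def] filterlim_at using LIMSEQ_inverse_real_of_nat by auto
  have "(\<lambda>n. LINT x|lborel. q n x) \<longlonglongrightarrow> (LINT x|lborel. pd b \<psi> x)"
  proof (rule integral_dominated_convergence)
    \<comment> \<open>The steps \<open>t n\<close> are at most 1, so all translated supports stay in
      the ball of radius \<open>R + 1\<close>.\<close>
    show "integrable lborel (\<lambda>x. C * indicat_real (cball (0::'a) (R + 1)) x)"
      by (intro integrable_mult_right integrable_real_indicator) (use emeasure_bounded_finite[OF bounded_cball] in auto)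
    show "AE x in lborel. (\<lambda>n. q n x) \<longlonglongrightarrow> pd b \<psi> x"
    proof (intro AE_I2)
      fix x
      have "((\<lambda>h. (\<psi> (x + h *\<^sub>R b) - \<psi> x) / h) \<longlongrightarrow> pd b \<psi> x) (at 0)"
        using pd_DERIV[OF \<psi>, of x b 0] by (simp add: DERIV_def)
      from filterlim_compose[OF this tq] show "(\<lambda>n. q n x) \<longlonglongrightarrow> pd b \<psi> x"
        by (simp add: q_def)
    qed
    show "AE x in lborel. norm (q n x) \<le> C * indicat_real (cball 0 (R + 1)) x" for n
    proof (intro AE_I2)
      fix x
      show "norm (q n x) \<le> C * indicat_real (cball 0 (R + 1)) x"
      proof (cases "norm x \<le> R + 1")
        case True
        then show ?thesis
          using test_function_Lipschitz[OF \<psi> C(2), of x "t n"] t[of n]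
          by (simp add: q_def field_simps)
      next
        case False
        have "norm (t n *\<^sub>R b) \<le> 1" using t[of n] b by simp
        then have "R < norm (x + t n *\<^sub>R b)"
          using False norm_triangle_ineq4[of "x + t n *\<^sub>R b" "t n *\<^sub>R b"] by simp
        then show ?thesis using R[of x] R[of "x + t n *\<^sub>R b"] False by (simp add: q_def)
      qed
    qed
    show "pd b \<psi> \<in> borel_measurable lborel" using test_function_pd[OF assms] by simp
    show "q n \<in> borel_measurable lborel" for n unfolding q_def[abs_def] by measurable
  qed
  moreover have "(LINT x|lborel. q n x) = 0" for n
  proof -
    have i: "integrable lborel \<psi>" "integrable lborel (\<lambda>x. \<psi> (x + t n *\<^sub>R b))"
      using integrable_test_function test_function_translate[of \<psi> "- t n *\<^sub>R b"] \<psi> by force+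
    then show ?thesis
      by (simp add: q_def[abs_def] integral_translate[of \<psi>])
  qed
  ultimately show ?thesis by (simp add: LIMSEQ_const_iff)
qed

lemma test_function_integral_by_parts:
  assumes "test_function \<psi>" "test_function \<theta>" "b \<in> Basis"
  shows "(LINT x|lborel. pd b \<psi> x * \<theta> x) = - (LINT x|lborel. \<psi> x * pd b \<theta> x)"
proof -
  have "pd b (\<lambda>x. \<psi> x * \<theta> x) x = \<psi> x * pd b \<theta> x + pd b \<psi> x * \<theta> x" for x
  proof -
    have "((\<lambda>x. \<psi> x * \<theta> x) has_derivative (\<lambda>h. \<psi> x * frechet_derivative \<theta> (at x) h +
        frechet_derivative \<psi> (at x) h * \<theta> x)) (at x)"
      using assms(1,2) by (intro has_derivative_mult)
        (simp_all add: frechet_derivative_works[symmetric] test_function_differentiable)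
    from frechet_derivative_at[OF this, symmetric] show ?thesis by (simp add: pd_def)
  qed
  moreover have "integrable lborel (\<lambda>x. \<psi> x * pd b \<theta> x)" "integrable lborel (\<lambda>x. pd b \<psi> x * \<theta> x)"
    by (intro integrable_test_function test_function_mult test_function_pd assms)+
  ultimately show ?thesis
    using integral_pd_eq_0[OF test_function_mult[OF assms(1,2)] assms(3)] by simp
qed

section \<open>Weak derivatives and the weak eigenvalue equation\<close>

lemma borel_measurable_cnj [measurable (raw)]: "f \<in> borel_measurable M \<Longrightarrow> (\<lambda>x. cnj (f x)) \<in> borel_measurable M"
  by (rule borel_measurable_continuous_on[where f=cnj]) (intro continuous_intros)

lemma L2_funD:
  assumes "f \<in> L2_fun"
  shows "f \<in> borel_measurable borel" "integrable lborel (\<lambda>x. (cmod (f x))\<^sup>2)"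
  using assms by (simp_all add: L2_fun_def)

lemma L2_fun_mult_integrable:
  assumes "f \<in> L2_fun" "g \<in> L2_fun"
  shows "integrable lborel (\<lambda>x. f x * g x)"
proof (rule Bochner_Integration.integrable_bound)
  show "integrable lborel (\<lambda>x. (cmod (f x))\<^sup>2 + (cmod (g x))\<^sup>2)"
    using assms by (intro Bochner_Integration.integrable_add L2_funD)
  have "cmod (f x * g x) \<le> (cmod (f x))\<^sup>2 + (cmod (g x))\<^sup>2" for x
    using sum_squares_bound[of "cmod (f x)" "cmod (g x)"] norm_ge_zero[of "f x * g x"]
    unfolding norm_mult by linarith
  then show "AE x in lborel. norm (f x * g x) \<le> norm ((cmod (f x))\<^sup>2 + (cmod (g x))\<^sup>2)"
    by (intro AE_I2) (simp add: order_trans[OF _ abs_ge_self])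
  show "(\<lambda>x. f x * g x) \<in> borel_measurable lborel"
    using assms[THEN L2_funD(1)] by simp
qed

lemma L2_fun_test_function:
  assumes "test_function \<psi>"
  shows "(\<lambda>x. complex_of_real (\<psi> x)) \<in> L2_fun"
proof -
  have "\<psi> \<in> borel_measurable borel" using assms by (rule test_function_borel)
  moreover have "(cmod (complex_of_real (\<psi> x)))\<^sup>2 = \<psi> x * \<psi> x" for x
    by (simp add: power2_eq_square)
  ultimately show ?thesis
    using integrable_test_function[OF test_function_mult[OF assms assms]]
    by (simp add: L2_fun_def)
qed

text \<open>Serves to localise: an element of L2 need not be integrable, but its product with this
  indicator is, being a product of two elements of L2.\<close>

lemma L2_fun_indicator_cball:
  "(\<lambda>x. complex_of_real (indicat_real (cball (0::'a::euclidean_space) R) x)) \<in> L2_fun"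
proof -
  have "(cmod (complex_of_real (indicat_real (cball 0 R) x)))\<^sup>2 = indicat_real (cball 0 R) x" for x :: 'a
    by (simp add: indicator_def)
  moreover have "indicat_real (cball (0::'a) R) \<in> borel_measurable borel"
    by (rule borel_measurable_indicator) simp
  then have "(\<lambda>x. complex_of_real (indicat_real (cball (0::'a) R) x)) \<in> borel_measurable borel"
    by simp
  moreover have "integrable lborel (indicat_real (cball (0::'a) R))"
    using emeasure_bounded_finite[OF bounded_cball, of "0::'a" R]
    by (intro integrable_real_indicator) auto
  ultimately show ?thesis by (simp add: L2_fun_def)
qed

section \<open>From vanishing integrals to vanishing almost everywhere\<close>

text \<open>A pi-lambda argument: open boxes are stable under intersection and generate the Borel
  sets. The step to complements needs the integral over the whole space, which is a limit of
  integrals over growing boxes.\<close>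

lemma set_integral_eq_0_if_box:
  fixes h :: "'a::euclidean_space \<Rightarrow> complex"
  assumes h: "integrable lborel h"
    and box: "\<And>l u. (LINT x|lborel. indicat_real (box l u) x *\<^sub>R h x) = 0"
    and A: "A \<in> sets borel"
  shows "(LINT x|lborel. indicat_real A x *\<^sub>R h x) = 0"
proof -
  let ?E = "range (\<lambda>(a, b). box a b::'a set)"
  have "(LINT x|lborel. h x) = 0"
  proof -
    let ?B = "\<lambda>n::nat. box (- (real n *\<^sub>R One)) (real n *\<^sub>R One) :: 'a set"
    have "(\<lambda>n. LINT x|lborel. indicat_real (?B n) x *\<^sub>R h x) \<longlonglongrightarrow> (LINT x|lborel. h x)"
    proof (rule integral_dominated_convergence[where w="\<lambda>x. cmod (h x)"])
      show "AE x in lborel. (\<lambda>n. indicat_real (?B n) x *\<^sub>R h x) \<longlonglongrightarrow> h x"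
      proof (intro AE_I2 tendsto_eventually)
        fix x
        obtain N where N: "x \<in> ?B N"
          using UN_box_eq_UNIV by blast
        have "x \<in> ?B n" if "N \<le> n" for n
          using N that unfolding mem_box by (force simp: inner_diff_left)
        then show "\<forall>\<^sub>F n in sequentially. indicat_real (?B n) x *\<^sub>R h x = h x"
          by (auto simp: eventually_sequentially intro!: exI[of _ N])
      qed
    qed (use h in \<open>auto simp: indicator_def intro!: integrable_norm\<close>)
    then show ?thesis using box by (simp add: LIMSEQ_const_iff)
  qed
  note all = this
  have "A \<in> sigma_sets UNIV ?E"
    using A by (simp add: borel_eq_box)
  moreover have "Int_stable ?E" "?E \<subseteq> Pow UNIV"
    by (auto simp: Int_stable_def box_Int_box)
  ultimately have "Int_stable ?E" "?E \<subseteq> Pow UNIV" "A \<in> sigma_sets UNIV ?E" by blast+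
  then show ?thesis
  proof (induction rule: sigma_sets_induct_disjoint)
    case (basic A)
    then show ?case using box by auto
  next
    case empty
    then show ?case by simp
  next
    case (compl A)
    then have "A \<in> sets borel" by (simp add: borel_eq_box)
    then have "integrable lborel (\<lambda>x. indicat_real A x *\<^sub>R h x)"
      using h by (intro integrable_mult_indicator) simp_all
    moreover have "indicat_real (UNIV - A) x *\<^sub>R h x = h x - indicat_real A x *\<^sub>R h x" for x
      by (auto simp: indicator_def)
    ultimately show ?case using compl all h by simp
  next
    case (union A)
    then have m: "A i \<in> sets lborel" for i by (auto simp: borel_eq_box)
    then have "set_integrable lborel (\<Union>i. A i) h"
      unfolding set_integrable_def using h by (intro integrable_mult_indicator) auto
    from lebesgue_integral_countable_add[OF m _ this] union(1,3)
    show ?case by (auto simp: set_lebesgue_integral_def disjoint_family_on_def)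
  qed
qed

text \<open>The du Bois-Reymond lemma: the bumps \<open>box_bump n l u\<close> increase to the indicator of the box.\<close>

lemma AE_eq_0_if_test_function_integrals_0:
  fixes h :: "'a::euclidean_space \<Rightarrow> complex"
  assumes h: "h \<in> borel_measurable borel"
    and int: "\<And>R. integrable lborel (\<lambda>x. indicat_real (cball 0 R) x *\<^sub>R h x)"
    and test: "\<And>\<psi>. test_function \<psi> \<Longrightarrow> (LINT x|lborel. \<psi> x *\<^sub>R h x) = 0"
  shows "AE x in lborel. h x = 0"
proof -
  have box: "(LINT x|lborel. indicat_real (box l u) x *\<^sub>R h x) = 0" for l u
  proof -
    obtain R where R: "box l u \<subseteq> cball 0 R"
      using bounded_box[of l u] by (auto simp: bounded_iff subset_iff)
    let ?f = "\<lambda>n. box_bump (real (Suc n)) l u"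
    have "(\<lambda>n. LINT x|lborel. ?f n x *\<^sub>R h x) \<longlonglongrightarrow> (LINT x|lborel. indicat_real (box l u) x *\<^sub>R h x)"
    proof (rule integral_dominated_convergence)
      show "integrable lborel (\<lambda>x. norm (indicat_real (cball 0 R) x *\<^sub>R h x))"
        using int by (rule integrable_norm)
      show "AE x in lborel. (\<lambda>n. ?f n x *\<^sub>R h x) \<longlonglongrightarrow> indicat_real (box l u) x *\<^sub>R h x"
        by (intro AE_I2 tendsto_intros LIMSEQ_Suc[OF box_bump_tendsto])
      show "AE x in lborel. norm (?f n x *\<^sub>R h x) \<le> norm (indicat_real (cball 0 R) x *\<^sub>R h x)" for n
      proof (intro AE_I2)
        fix x
        show "norm (?f n x *\<^sub>R h x) \<le> norm (indicat_real (cball 0 R) x *\<^sub>R h x)"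
        proof (cases "x \<in> box l u")
          case True
          then have "x \<in> cball 0 R" using R by blast
          with box_bump_le_1[of "real (Suc n)" l u x] box_bump_nonneg[of "real (Suc n)" l u x]
          show ?thesis by (simp add: mult_left_le_one_le)
        next
          case False
          then show ?thesis using box_bump_eq_0_iff[of "real (Suc n)" l u x] by simp
        qed
      qed
      have "?f n \<in> borel_measurable borel" for n
        by (intro test_function_borel test_function_box_bump) simp
      then show "(\<lambda>x. ?f n x *\<^sub>R h x) \<in> borel_measurable lborel" for n
        using h by simp
    qed (use h in simp)
    moreover have "(LINT x|lborel. ?f n x *\<^sub>R h x) = 0" for n
      by (intro test test_function_box_bump) simp
    ultimately show ?thesis by (simp add: LIMSEQ_const_iff)
  qed
  let ?B = "\<lambda>n::nat. box (- (real n *\<^sub>R One)) (real n *\<^sub>R One) :: 'a set"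
  have "AE x in lborel. indicat_real (?B n) x *\<^sub>R h x = 0" for n
  proof -
    obtain R where R: "?B n \<subseteq> cball 0 R"
      using bounded_box[of "- (real n *\<^sub>R One)" "real n *\<^sub>R One :: 'a"] by (auto simp: bounded_iff subset_iff)
    have "integrable lborel (\<lambda>x. indicat_real (?B n) x *\<^sub>R (indicat_real (cball 0 R) x *\<^sub>R h x))"
      by (rule integrable_mult_indicator[OF _ int]) simp
    also have "(\<lambda>x. indicat_real (?B n) x *\<^sub>R (indicat_real (cball 0 R) x *\<^sub>R h x)) =
        (\<lambda>x. indicat_real (?B n) x *\<^sub>R h x)"
      using R by (auto simp: indicator_def fun_eq_iff simp del: mem_cball mem_cball_0)
    finally have i: "integrable lborel (\<lambda>x. indicat_real (?B n) x *\<^sub>R h x)" .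
    \<comment> \<open>Two open boxes intersect in an open box, so the vanishing box integrals pass
      to the function cut off to \<open>?B n\<close>. That function is integrable, hence has
      integral 0 over every Borel set and is 0 almost everywhere, as a density equal to the density
      0.\<close>
    have b: "(LINT x|lborel. indicat_real (box l u) x *\<^sub>R (indicat_real (?B n) x *\<^sub>R h x)) = 0" for l u
      by (simp add: indicator_inter_arith[symmetric] box_Int_box box)
    show ?thesis
      using sigma_finite_measure.density_unique_banach[OF sigma_finite_lborel i, of "\<lambda>_. 0"] set_integral_eq_0_if_box[OF i b]
      by (simp add: set_lebesgue_integral_def)
  qed
  then have "AE x in lborel. \<forall>n. indicat_real (?B n) x *\<^sub>R h x = 0"
    by (subst AE_all_countable) iprover
  then show ?thesis
  proof eventually_elim
    case (elim x)
    obtain n where "x \<in> ?B n" using UN_box_eq_UNIV by blast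
    with elim show ?case by (auto dest: spec[of _ n])
  qed
qed

section \<open>Weak derivatives and the distributional form of the eigenvalue equation\<close>

lemma has_weak_partial_test_function:
  assumes "test_function \<psi>" "b \<in> Basis"
  shows "has_weak_partial (\<lambda>x. complex_of_real (\<psi> x)) b (\<lambda>x. complex_of_real (pd b \<psi> x))"
  unfolding has_weak_partial_def
proof (intro conjI allI impI)
  fix \<theta> :: "'a \<Rightarrow> real" assume \<theta>: "test_function \<theta>"
  show "(LINT x|lborel. frechet_derivative \<theta> (at x) b *\<^sub>R complex_of_real (\<psi> x)) =
      - (LINT x|lborel. \<theta> x *\<^sub>R complex_of_real (pd b \<psi> x))"
    using test_function_integral_by_parts[OF \<theta> assms]
    by (simp add: scaleR_conv_of_real pd_def flip: of_real_mult of_real_minus)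
qed (use assms in \<open>auto intro: L2_fun_test_function test_function_pd\<close>)

lemma has_weak_partial_weak_partial:
  "has_weak_partial u b g \<Longrightarrow> has_weak_partial u b (weak_partial b u)"
  unfolding weak_partial_def by (rule someI[of "has_weak_partial u b"])

text \<open>Both candidates have the same integrals against all test functions, so their difference
  vanishes almost everywhere. This tames the arbitrary choice in \<open>weak_partial\<close>: for a
  test function the chosen derivative is almost everywhere the classical one.\<close>

lemma has_weak_partial_unique:
  assumes "has_weak_partial u b g" "has_weak_partial u b g'"
  shows "AE x in lborel. g x = g' x"
proof -
  have L2: "g \<in> L2_fun" "g' \<in> L2_fun" using assms by (auto simp: has_weak_partial_def)
  have i: "integrable lborel (\<lambda>x. f x *\<^sub>R g x)" "integrable lborel (\<lambda>x. f x *\<^sub>R g' x)"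
    if "(\<lambda>x. complex_of_real (f x)) \<in> L2_fun" for f
    using L2_fun_mult_integrable[OF that] L2 by (simp_all add: scaleR_conv_of_real)
  have "AE x in lborel. g x - g' x = 0"
  proof (rule AE_eq_0_if_test_function_integrals_0)
    show "(\<lambda>x. g x - g' x) \<in> borel_measurable borel" using L2[THEN L2_funD(1)] by simp
    show "integrable lborel (\<lambda>x. indicat_real (cball 0 R) x *\<^sub>R (g x - g' x))" for R
      unfolding scaleR_diff_right
      by (rule Bochner_Integration.integrable_diff[OF i[OF L2_fun_indicator_cball]])
    show "(LINT x|lborel. \<psi> x *\<^sub>R (g x - g' x)) = 0" if "test_function \<psi>" for \<psi>
    proof -
      have "(LINT x|lborel. \<psi> x *\<^sub>R g x) = (LINT x|lborel. \<psi> x *\<^sub>R g' x)"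
        using assms that by (simp add: has_weak_partial_def)
      then show ?thesis
        unfolding scaleR_diff_right
        using i[OF L2_fun_test_function[OF that]] by simp
    qed
  qed
  then show ?thesis by simp
qed

lemma integrable_test_function_scaleR_L2:
  "test_function \<psi> \<Longrightarrow> u \<in> L2_fun \<Longrightarrow> integrable lborel (\<lambda>x. \<psi> x *\<^sub>R u x)"
  using L2_fun_mult_integrable[OF L2_fun_test_function] by (simp add: scaleR_conv_of_real)

lemma test_function_in_form_domain:
  fixes V :: "'a::euclidean_space \<Rightarrow> real"
  assumes "test_function \<psi>" "V \<in> borel_measurable borel" "\<And>R. bounded (V ` cball 0 R)"
  shows "(\<lambda>x. complex_of_real (\<psi> x)) \<in> form_domain V"
proof -
  have "integrable lborel (\<lambda>x. V x * (cmod (complex_of_real (\<psi> x)))\<^sup>2)"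
    using integrable_test_function_mult[OF test_function_mult[OF assms(1,1)] assms(2,3)]
    by (simp add: power2_eq_square mult.commute)
  then show ?thesis
    using L2_fun_test_function[OF assms(1)] has_weak_partial_test_function[OF assms(1)]
    unfolding form_domain_def by blast
qed

text \<open>The weak gradient of \<open>u\<close> is paired with \<open>pd b \<psi>\<close>, again a
  test function, so the definition of the weak derivative can be applied once more and moves the
  last derivative onto \<open>\<psi>\<close>.\<close>

lemma schrodinger_form_test_function:
  fixes V :: "'a::euclidean_space \<Rightarrow> real"
  assumes u: "u \<in> form_domain V" and \<psi>: "test_function \<psi>"
  shows "schrodinger_form V u (\<lambda>x. complex_of_real (\<psi> x)) =
    (LINT x|lborel. complex_of_real (V x) * u x * complex_of_real (\<psi> x)) -
    (LINT x|lborel. laplacian \<psi> x *\<^sub>R u x)"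
proof -
  let ?\<psi> = "\<lambda>x. complex_of_real (\<psi> x)"
  have uL2: "u \<in> L2_fun" using u by (simp add: form_domain_def)
  have "L2_inner (weak_partial b u) (weak_partial b ?\<psi>) = - (LINT x|lborel. pd b (pd b \<psi>) x *\<^sub>R u x)"
    if b: "b \<in> Basis" for b
  proof -
    have wu: "has_weak_partial u b (weak_partial b u)"
      using u b unfolding form_domain_def by (blast intro: has_weak_partial_weak_partial)
    have w\<psi>: "has_weak_partial ?\<psi> b (weak_partial b ?\<psi>)"
      using has_weak_partial_weak_partial[OF has_weak_partial_test_function[OF \<psi> b]] .
    have [measurable]: "weak_partial b u \<in> borel_measurable borel"
      "weak_partial b ?\<psi> \<in> borel_measurable borel" "pd b \<psi> \<in> borel_measurable borel"
      using wu w\<psi> test_function_pd[OF \<psi> b] by (auto simp: has_weak_partial_def intro: L2_funD)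
    have "AE x in lborel. weak_partial b ?\<psi> x = complex_of_real (pd b \<psi> x)"
      by (rule has_weak_partial_unique[OF w\<psi> has_weak_partial_test_function[OF \<psi> b]])
    then have "L2_inner (weak_partial b u) (weak_partial b ?\<psi>) =
        (LINT x|lborel. weak_partial b u x * cnj (complex_of_real (pd b \<psi> x)))"
      unfolding L2_inner_def
      by (intro integral_cong_AE)
        (measurable, auto)
    also have "\<dots> = (LINT x|lborel. pd b \<psi> x *\<^sub>R weak_partial b u x)"
      by (simp add: scaleR_conv_of_real mult.commute)
    also have "\<dots> = - (LINT x|lborel. pd b (pd b \<psi>) x *\<^sub>R u x)"
      using wu test_function_pd[OF \<psi> b] by (simp add: has_weak_partial_def pd_def[of b "pd b \<psi>"])
    finally show ?thesis .
  qed
  then have "(\<Sum>b\<in>Basis. L2_inner (weak_partial b u) (weak_partial b ?\<psi>)) =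
      - (\<Sum>b\<in>Basis. LINT x|lborel. pd b (pd b \<psi>) x *\<^sub>R u x)"
    by (simp add: sum_negf)
  also have "(\<Sum>b\<in>Basis. LINT x|lborel. pd b (pd b \<psi>) x *\<^sub>R u x) =
      (LINT x|lborel. laplacian \<psi> x *\<^sub>R u x)"
    unfolding laplacian_def scaleR_sum_left using uL2
    by (intro Bochner_Integration.integral_sum[symmetric] integrable_test_function_scaleR_L2
        test_function_pd \<psi>)
  finally show ?thesis by (simp add: schrodinger_form_def)
qed

lemma bounded_image_cball_continuous:
  "continuous_on UNIV (f :: 'a::euclidean_space \<Rightarrow> real) \<Longrightarrow> bounded (f ` cball 0 R)"
  using continuous_on_subset[of UNIV f "cball 0 R"]
  by (intro compact_imp_bounded compact_continuous_image) auto

lemma integrable_continuous_mult_test: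
  assumes "continuous_on UNIV f" "test_function \<psi>"
  shows "integrable lborel (\<lambda>y. f y * \<psi> y)"
  using integrable_test_function_mult[OF assms(2) borel_measurable_continuous_onI[OF assms(1)]
      bounded_image_cball_continuous[OF assms(1)]] by (simp add: mult.commute)

lemma integrable_potential_mult_test:
  fixes V \<phi> :: "'a::euclidean_space \<Rightarrow> real"
  assumes \<phi>: "continuous_on UNIV \<phi>"
    and V: "V \<in> borel_measurable borel" "\<And>R. bounded (V ` cball 0 R)"
    and \<psi>: "test_function \<psi>"
  shows "integrable lborel (\<lambda>x. (V x - \<mu>) * \<phi> x * \<psi> x)"
proof -
  have "integrable lborel (\<lambda>x. \<psi> x * ((V x - \<mu>) * \<phi> x))"
  proof (rule integrable_test_function_mult[OF \<psi>])
    show "(\<lambda>x. (V x - \<mu>) * \<phi> x) \<in> borel_measurable borel"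
      using V(1) borel_measurable_continuous_onI[OF \<phi>] by simp
    fix R
    obtain B C where B: "\<And>x. x \<in> cball 0 R \<Longrightarrow> \<bar>V x\<bar> \<le> B" and C: "\<And>x. x \<in> cball 0 R \<Longrightarrow> \<bar>\<phi> x\<bar> \<le> C"
      using V(2)[of R] bounded_image_cball_continuous[OF \<phi>, of R]
      unfolding bounded_iff real_norm_def by blast
    have "norm ((V x - \<mu>) * \<phi> x) \<le> (B + \<bar>\<mu>\<bar>) * C" if "x \<in> cball 0 R" for x
      unfolding real_norm_def abs_mult
      using B[OF that] C[OF that] abs_ge_zero[of "V x"] abs_ge_zero[of "\<phi> x"]
      by (intro mult_mono) linarith+
    then show "bounded ((\<lambda>x. (V x - \<mu>) * \<phi> x) ` cball 0 R)" unfolding bounded_iff by blast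
  qed
  then show ?thesis by (simp add: mult.commute)
qed

lemma eigenfunction_weak_equation:
  fixes V \<phi> :: "'a::euclidean_space \<Rightarrow> real"
  assumes V: "V \<in> borel_measurable borel" "\<And>R. bounded (V ` cball 0 R)"
    and \<phi>: "continuous_on UNIV \<phi>"
    and eig: "(\<lambda>x. complex_of_real (\<phi> x), \<lambda>x. complex_of_real (\<mu> * \<phi> x)) \<in> schrodinger_op V"
    and \<psi>: "test_function \<psi>"
  shows "(LINT x|lborel. \<phi> x * laplacian \<psi> x) = (LINT x|lborel. (V x - \<mu>) * \<phi> x * \<psi> x)"
proof -
  let ?\<phi> = "\<lambda>x. complex_of_real (\<phi> x)" and ?\<psi> = "\<lambda>x. complex_of_real (\<psi> x)"
  have u: "?\<phi> \<in> form_domain V" using eig by (simp add: schrodinger_op_def)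
  have "schrodinger_form V ?\<phi> ?\<psi> = L2_inner (\<lambda>x. complex_of_real (\<mu> * \<phi> x)) ?\<psi>"
    using eig test_function_in_form_domain[OF \<psi> V] by (simp add: schrodinger_op_def)
  \<comment> \<open>All functions involved are real-valued, so the complex identity is the image of
    a real one.\<close>
  then have "complex_of_real ((LINT x|lborel. V x * \<phi> x * \<psi> x) - (LINT x|lborel. laplacian \<psi> x * \<phi> x)) =
      complex_of_real (LINT x|lborel. \<mu> * \<phi> x * \<psi> x)"
    unfolding schrodinger_form_test_function[OF u \<psi>] L2_inner_def
    by (simp add: scaleR_conv_of_real flip: of_real_mult of_real_diff)
  then have eq: "(LINT x|lborel. V x * \<phi> x * \<psi> x) - (LINT x|lborel. laplacian \<psi> x * \<phi> x) =
      (LINT x|lborel. \<mu> * \<phi> x * \<psi> x)"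
    by (simp only: of_real_eq_iff)
  have "integrable lborel (\<lambda>x. V x * \<phi> x * \<psi> x)"
    using integrable_potential_mult_test[OF \<phi> V \<psi>, of 0] by simp
  moreover have "integrable lborel (\<lambda>x. \<mu> * \<phi> x * \<psi> x)"
    using integrable_continuous_mult_test[OF \<phi> \<psi>] by (simp add: mult.assoc)
  ultimately have "(LINT x|lborel. (V x - \<mu>) * \<phi> x * \<psi> x) =
      (LINT x|lborel. V x * \<phi> x * \<psi> x) - (LINT x|lborel. \<mu> * \<phi> x * \<psi> x)"
    by (simp only: left_diff_distrib Bochner_Integration.integral_diff)
  with eq show ?thesis by (simp add: mult.commute)
qed

section \<open>The weak comparison principle\<close>

text \<open>L'Hopital is used only once, because \<open>f'\<close> is assumed differentiable at 0
  alone. The resulting quotient (f'(t) - f'(-t)) / (2 t) is the mean of the difference quotients of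
  \<open>f'\<close> at 0 with steps t and -t, and both tend to \<open>c\<close>.\<close>

lemma second_difference_tendsto:
  fixes f :: "real \<Rightarrow> real"
  assumes e: "0 < e"
    and f: "\<And>t. \<bar>t\<bar> < e \<Longrightarrow> (f has_real_derivative f' t) (at t)"
    and f': "(f' has_real_derivative c) (at 0)"
  shows "((\<lambda>t. (f t + f (- t) - 2 * f 0) / t\<^sup>2) \<longlongrightarrow> c) (at_right 0)"
proof (rule lhopital_right_0)
  have ev: "\<forall>\<^sub>F t in at_right 0. 0 < t \<and> t < e"
    using e by (auto simp: eventually_at_right_field)
  have cont: "isCont f 0" using f[of 0] e by (intro DERIV_isCont) auto
  have "((\<lambda>t. f t + f (- t) - 2 * f 0) \<longlongrightarrow> f 0 + f (- 0) - 2 * f 0) (at 0)"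
    by (intro tendsto_intros isContD[OF cont] isCont_tendsto_compose[of _ f])
      (use cont in \<open>auto intro!: tendsto_eq_intros\<close>)
  then show "((\<lambda>t. f t + f (- t) - 2 * f 0) \<longlongrightarrow> 0) (at_right 0)"
    by (auto intro: filterlim_at_split[THEN iffD1, THEN conjunct2])
  show "((\<lambda>t::real. t\<^sup>2) \<longlongrightarrow> 0) (at_right 0)" by (auto intro!: tendsto_eq_intros)
  show "\<forall>\<^sub>F t in at_right 0. t\<^sup>2 \<noteq> (0::real)" "\<forall>\<^sub>F t in at_right 0. 2 * t \<noteq> (0::real)"
    using ev by (auto elim!: eventually_mono)
  show "\<forall>\<^sub>F t in at_right 0. ((\<lambda>t. t\<^sup>2) has_real_derivative 2 * t) (at t)"
    by (auto intro!: derivative_eq_intros always_eventually)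
  show "\<forall>\<^sub>F t in at_right 0. ((\<lambda>t. f t + f (- t) - 2 * f 0) has_real_derivative f' t - f' (- t)) (at t)"
    using ev
  proof eventually_elim
    case (elim t)
    then have "((\<lambda>t. f (- t)) has_real_derivative f' (- t) * (- 1)) (at t)"
      by (intro DERIV_chain2[of f] f) (auto intro!: derivative_eq_intros)
    with elim show ?case by (auto intro!: derivative_eq_intros f)
  qed
  have L: "((\<lambda>t. (f' t - f' 0) / t) \<longlongrightarrow> c) (at 0)" using f' by (simp add: DERIV_def)
  have r: "filterlim (\<lambda>t::real. t) (at 0) (at_right 0)" "filterlim (\<lambda>t::real. - t) (at 0) (at_right 0)"
    by (auto simp: filterlim_at eventually_at_filter intro!: tendsto_eq_intros)
  have "((\<lambda>t. ((f' t - f' 0) / t + (f' (- t) - f' 0) / (- t)) / 2) \<longlongrightarrow> (c + c) / 2) (at_right 0)"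
    by (intro tendsto_intros filterlim_compose[OF L r(1)] filterlim_compose[OF L r(2)]) simp
  moreover have "(c + c) / 2 = c" by simp
  ultimately have "((\<lambda>t. ((f' t - f' 0) / t + (f' (- t) - f' 0) / (- t)) / 2) \<longlongrightarrow> c) (at_right 0)"
    by (simp only:)
  then show "((\<lambda>t. (f' t - f' (- t)) / (2 * t)) \<longlongrightarrow> c) (at_right 0)"
    by (rule Lim_transform_eventually)
      (use ev in \<open>auto elim!: eventually_mono simp: field_simps\<close>)
qed

text \<open>The mean value inequality is applied twice, first to \<open>f'\<close> between -s and s,
  then to the second difference as a function of the step. The constant is not sharp; the bound
  serves only as a domination uniform in the step.\<close>

lemma second_difference_bound:
  fixes f :: "real \<Rightarrow> real"
  assumes f: "\<And>t. (f has_real_derivative f' t) (at t)"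
    and f': "\<And>t. (f' has_real_derivative f'' t) (at t)"
    and C: "\<And>t. \<bar>f'' t\<bar> \<le> C"
    and t: "0 \<le> t"
  shows "\<bar>f t + f (- t) - 2 * f 0\<bar> \<le> 2 * C * t\<^sup>2"
proof -
  let ?h = "\<lambda>t. f t + f (- t) - 2 * f 0"
  have "0 \<le> C" using C[of 0] by linarith
  have "\<bar>f' s - f' (- s)\<bar> \<le> 2 * C * t" if "0 \<le> s" "s \<le> t" for s
  proof -
    have "\<bar>f' s - f' (- s)\<bar> \<le> C * \<bar>s - (- s)\<bar>"
      using field_differentiable_bound[of UNIV f' f'' C s "- s"] f' C
      by (simp add: has_field_derivative_at_within)
    also have "\<dots> \<le> 2 * C * t" using that \<open>0 \<le> C\<close> by (simp add: mult_left_mono)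
    finally show ?thesis .
  qed
  moreover have "(?h has_real_derivative f' s - f' (- s)) (at s)" for s
  proof -
    have "((\<lambda>t. f (- t)) has_real_derivative f' (- s) * (- 1)) (at s)"
      by (intro DERIV_chain2[of f] f) (auto intro!: derivative_eq_intros)
    then show ?thesis by (auto intro!: derivative_eq_intros f)
  qed
  ultimately have "\<bar>?h t - ?h 0\<bar> \<le> 2 * C * t * \<bar>t - 0\<bar>"
    using field_differentiable_bound[of "{0..t}" ?h "\<lambda>s. f' s - f' (- s)" "2 * C * t" t 0] t
    by (simp add: has_field_derivative_at_within)
  then show ?thesis using t by (simp add: power2_eq_square)
qed

text \<open>A sequence of steps, since dominated convergence is a statement about sequences. The
  shift by one keeps the steps nonzero, and the bound 1 confines translated supports to one
  ball.\<close>

definition unit_step :: "nat \<Rightarrow> real" where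
  "unit_step n = inverse (real (Suc n))"

lemma unit_step: "0 < unit_step n" "unit_step n \<le> 1"
  by (auto simp: unit_step_def field_simps)

lemma filterlim_unit_step: "filterlim unit_step (at_right 0) sequentially"
proof -
  have "unit_step \<longlonglongrightarrow> 0"
    unfolding unit_step_def[abs_def] by (rule LIMSEQ_inverse_real_of_nat)
  moreover have "unit_step n \<noteq> 0" for n using unit_step(1)[of n] by simp
  ultimately show ?thesis using unit_step(1) by (simp add: filterlim_at)
qed

text \<open>\<open>u\<close> is merely continuous, so the difference quotients are taken on
  \<open>\<psi>\<close>, where they converge boundedly. When \<open>\<psi>\<close> is a translated
  mollifier, the quotient on the left is the second difference of the mollified \<open>u\<close>,
  and the limit is its second derivative.\<close>

lemma test_function_second_difference:
  fixes u :: "'a::euclidean_space \<Rightarrow> real"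
  assumes u: "continuous_on UNIV u" and \<psi>: "test_function \<psi>" and b: "b \<in> Basis"
  shows "(\<lambda>n. ((LINT y|lborel. u y * \<psi> (y + unit_step n *\<^sub>R b)) +
      (LINT y|lborel. u y * \<psi> (y - unit_step n *\<^sub>R b)) -
      2 * (LINT y|lborel. u y * \<psi> y)) / (unit_step n)\<^sup>2)
    \<longlonglongrightarrow> (LINT y|lborel. u y * pd b (pd b \<psi>) y)"
proof -
  let ?t = unit_step
  define q where "q n y = (\<psi> (y + ?t n *\<^sub>R b) + \<psi> (y - ?t n *\<^sub>R b) - 2 * \<psi> y) / (?t n)\<^sup>2" for n y
  have \<psi>1: "test_function (pd b \<psi>)" and \<psi>2: "test_function (pd b (pd b \<psi>))"
    using \<psi> b by (simp_all add: test_function_pd)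
  have [measurable]: "\<psi> \<in> borel_measurable borel" "pd b (pd b \<psi>) \<in> borel_measurable borel"
    using \<psi> \<psi>2 by simp_all
  have [measurable]: "u \<in> borel_measurable borel" using u by (rule borel_measurable_continuous_onI)
  obtain C where C: "0 \<le> C" "\<And>x. \<bar>pd b (pd b \<psi>) x\<bar> \<le> C"
    by (rule test_function_bounds[OF \<psi>2]) blast
  obtain R where R: "\<And>x. R < norm x \<Longrightarrow> \<psi> x = 0"
    by (rule test_function_bounds[OF \<psi>]) blast
  obtain B where B: "\<And>y. y \<in> cball 0 (R + 1) \<Longrightarrow> \<bar>u y\<bar> \<le> B"
    using bounded_image_cball_continuous[OF u, of "R + 1"] unfolding bounded_iff real_norm_def by blast
  have D1: "((\<lambda>t. \<psi> (y + t *\<^sub>R b)) has_real_derivative pd b \<psi> (y + t *\<^sub>R b)) (at t)" for y t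
    by (rule pd_DERIV[OF \<psi>])
  have D2: "((\<lambda>t. pd b \<psi> (y + t *\<^sub>R b)) has_real_derivative pd b (pd b \<psi>) (y + t *\<^sub>R b)) (at t)" for y t
    by (rule pd_DERIV[OF \<psi>1])
  have "(\<lambda>n. LINT y|lborel. u y * q n y) \<longlonglongrightarrow> (LINT y|lborel. u y * pd b (pd b \<psi>) y)"
  proof (rule integral_dominated_convergence)
    show "integrable lborel (\<lambda>x. (B * (2 * C)) * indicat_real (cball (0::'a) (R + 1)) x)"
      by (intro integrable_mult_right integrable_real_indicator)
        (use emeasure_bounded_finite[OF bounded_cball] in auto)
    show "AE y in lborel. (\<lambda>n. u y * q n y) \<longlonglongrightarrow> u y * pd b (pd b \<psi>) y"
    proof (intro AE_I2 tendsto_mult tendsto_const)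
      fix y
      have "((\<lambda>t. (\<psi> (y + t *\<^sub>R b) + \<psi> (y + (- t) *\<^sub>R b) - 2 * \<psi> (y + 0 *\<^sub>R b)) / t\<^sup>2) \<longlongrightarrow>
          pd b (pd b \<psi>) (y + 0 *\<^sub>R b)) (at_right 0)"
        by (rule second_difference_tendsto[OF zero_less_one D1 D2])
      from filterlim_compose[OF this filterlim_unit_step]
      show "(\<lambda>n. q n y) \<longlonglongrightarrow> pd b (pd b \<psi>) y" by (simp add: q_def)
    qed
    show "AE y in lborel. norm (u y * q n y) \<le> (B * (2 * C)) * indicat_real (cball 0 (R + 1)) y" for n
    proof (intro AE_I2)
      fix y
      show "norm (u y * q n y) \<le> (B * (2 * C)) * indicat_real (cball 0 (R + 1)) y"
      proof (cases "norm y \<le> R + 1")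
        case True
        have "\<bar>\<psi> (y + ?t n *\<^sub>R b) + \<psi> (y + (- ?t n) *\<^sub>R b) - 2 * \<psi> (y + 0 *\<^sub>R b)\<bar> \<le> 2 * C * (?t n)\<^sup>2"
          using unit_step(1)[of n] by (intro second_difference_bound[OF D1 D2] C) simp
        then have "\<bar>q n y\<bar> \<le> 2 * C"
          using unit_step(1)[of n] by (simp add: q_def field_simps abs_mult)
        moreover have "\<bar>u y\<bar> \<le> B" using B True by simp
        ultimately have "\<bar>u y\<bar> * \<bar>q n y\<bar> \<le> B * (2 * C)"
          by (intro mult_mono) linarith+
        then show ?thesis using True by (simp add: abs_mult)
      next
        case False
        have n: "norm (?t n *\<^sub>R b) \<le> 1" using unit_step[of n] b by simp
        then have "R < norm (y + ?t n *\<^sub>R b)" "R < norm (y - ?t n *\<^sub>R b)" "R < norm y"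
          using False norm_triangle_ineq4[of "y + ?t n *\<^sub>R b" "?t n *\<^sub>R b"]
            norm_triangle_ineq[of "y - ?t n *\<^sub>R b" "?t n *\<^sub>R b"] by simp_all
        then show ?thesis using R False by (simp add: q_def)
      qed
    qed
    show "(\<lambda>y. u y * q n y) \<in> borel_measurable lborel" for n unfolding q_def by measurable
  qed measurable
  moreover have "(LINT y|lborel. u y * q n y) = ((LINT y|lborel. u y * \<psi> (y + ?t n *\<^sub>R b)) +
      (LINT y|lborel. u y * \<psi> (y - ?t n *\<^sub>R b)) - 2 * (LINT y|lborel. u y * \<psi> y)) / (?t n)\<^sup>2" for n
  proof -
    have i: "integrable lborel (\<lambda>y. u y * \<theta> y)" if "test_function \<theta>" for \<theta>
      using integrable_test_function_mult[OF that _ bounded_image_cball_continuous[OF u]]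
      by (simp add: mult.commute)
    have "integrable lborel (\<lambda>y. u y * \<psi> (y + ?t n *\<^sub>R b))"
      "integrable lborel (\<lambda>y. u y * \<psi> (y - ?t n *\<^sub>R b))"
      using i[OF test_function_translate[OF \<psi>], of "- ?t n *\<^sub>R b"]
        i[OF test_function_translate[OF \<psi>], of "?t n *\<^sub>R b"] by simp_all
    with i[OF \<psi>] show ?thesis
      by (simp add: q_def right_diff_distrib distrib_left mult.left_commute[of _ 2])
  qed
  ultimately show ?thesis by simp
qed

section \<open>Mollifiers\<close>

lemma ex_mollifier:
  assumes "0 < \<eta>"
  obtains \<rho> :: "'a::euclidean_space \<Rightarrow> real" where "test_function \<rho>" "\<And>z. 0 \<le> \<rho> z"
    "(LINT z|lborel. \<rho> z) = 1" "\<And>z. \<rho> z \<noteq> 0 \<Longrightarrow> norm z \<le> \<eta>"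
proof -
  \<comment> \<open>A centred box of half-side \<eta>/d lies in the ball of radius \<eta>, because
    the Euclidean norm is at most the sum of the d absolute coordinates.\<close>
  define e where "e = \<eta> / DIM('a)"
  have e: "0 < e" using assms by (simp add: e_def)
  define l u :: 'a where "l = - (e *\<^sub>R One)" and "u = e *\<^sub>R One"
  let ?f = "box_bump 1 l u"
  define I where "I = (LINT z|lborel. ?f z)"
  have t: "test_function ?f" by (rule test_function_box_bump) simp
  \<comment> \<open>The bump is positive exactly on the box; a zero integral would make this box of
    positive volume a null set.\<close>
  have "I \<noteq> 0"
  proof
    assume "I = 0"
    then have "AE z in lborel. ?f z = 0"
      using integral_nonneg_eq_0_iff_AE[OF integrable_test_function[OF t] AE_I2[OF box_bump_nonneg]]
      by (simp add: I_def)
    then have "AE z in lborel. z \<notin> box l u" by (simp add: box_bump_eq_0_iff)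
    then have "emeasure lborel (box l u) = 0"
      by (subst (asm) AE_iff_measurable[of "box l u"]) auto
    moreover have "0 < (\<Prod>b\<in>Basis. (u - l) \<bullet> b)"
      using e by (intro prod_pos) (simp add: l_def u_def inner_diff_left inner_add_left)
    ultimately show False
      using e by (subst (asm) emeasure_lborel_box) (auto simp: l_def u_def inner_add_left)
  qed
  moreover have "0 \<le> I" unfolding I_def by (intro Bochner_Integration.integral_nonneg box_bump_nonneg)
  ultimately have I: "0 < I" by simp
  have "C_diff k (\<lambda>z. ?f z * (1 / I))" for k
    using t by (intro C_diff_mult C_diff_const) (simp add: test_function_def)
  then have "test_function (\<lambda>z. ?f z * (1 / I))"
    using t I by (simp add: test_function_def)
  moreover have "(LINT z|lborel. ?f z * (1 / I)) = 1"
    using I by (simp add: I_def[symmetric])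
  moreover have "norm z \<le> \<eta>" if "?f z * (1 / I) \<noteq> 0" for z
  proof -
    have "z \<in> box l u" using that box_bump_eq_0_iff[of 1 l u z] by auto
    then have "\<bar>z \<bullet> b\<bar> \<le> e" if "b \<in> Basis" for b
      using that by (auto simp: mem_box l_def u_def abs_le_iff dest!: bspec)
    then have "(\<Sum>b\<in>Basis. \<bar>z \<bullet> b\<bar>) \<le> DIM('a) * e" 
      using sum_bounded_above[of Basis "\<lambda>b. \<bar>z \<bullet> b\<bar>" e] by simp
    also have "\<dots> = \<eta>" by (simp add: e_def)
    finally show ?thesis using norm_le_l1[of z] by simp
  qed
  ultimately show thesis
    using I box_bump_nonneg[of 1 l u] by (intro that[of "\<lambda>z. ?f z * (1 / I)"]) simp_all
qed

lemma mollifier_integral_bound: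
  fixes f :: "'a::euclidean_space \<Rightarrow> real"
  assumes \<rho>: "test_function \<rho>" "\<And>z. 0 \<le> \<rho> z" "(LINT z|lborel. \<rho> z) = 1"
    and f: "continuous_on UNIV f" "\<And>z. \<rho> z \<noteq> 0 \<Longrightarrow> \<bar>f z\<bar> \<le> e"
  shows "\<bar>LINT z|lborel. f z * \<rho> z\<bar> \<le> e"
proof -
  have "integrable lborel (\<lambda>z. \<rho> z * f z)"
    using \<rho>(1) f(1) borel_measurable_continuous_onI bounded_image_cball_continuous
    by (intro integrable_test_function_mult) blast+
  then have fi: "integrable lborel (\<lambda>z. f z * \<rho> z)" by (simp add: mult.commute)
  have "norm (LINT z|lborel. f z * \<rho> z) \<le> (LINT z|lborel. e * \<rho> z)"
  proof (rule Bochner_Integration.integral_norm_bound_integral[OF fi])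
    show "integrable lborel (\<lambda>z. e * \<rho> z)"
      using integrable_test_function[OF \<rho>(1)] by simp
    show "norm (f z * \<rho> z) \<le> e * \<rho> z" for z
      using f(2)[of z] \<rho>(2)[of z] by (cases "\<rho> z = 0") (simp_all add: abs_mult mult_right_mono)
  qed
  also have "\<dots> = e" using \<rho>(3) by simp
  finally show ?thesis by simp
qed

text \<open>Only \<open>u\<close> is mollified; a positive maximum \<open>p\<close> of the difference with \<open>w\<close> then contradicts the
  two differential inequalities via second differences at \<open>p\<close>.\<close>

lemma weak_comparison:
  fixes u w :: "'a::euclidean_space \<Rightarrow> real"
  assumes u: "continuous_on UNIV u" and w: "continuous_on K w"
    and K: "compact K" "open U" "U \<subseteq> K" and x: "x \<in> K"
    and bdry: "\<And>y. y \<in> K - U \<Longrightarrow> u y \<le> w y"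
    and k: "0 < k"
    and sub: "\<And>\<psi>. test_function \<psi> \<Longrightarrow> (\<And>y. 0 \<le> \<psi> y) \<Longrightarrow> (\<And>y. y \<notin> U \<Longrightarrow> \<psi> y = 0) \<Longrightarrow>
      k * (LINT y|lborel. u y * \<psi> y) \<le> (LINT y|lborel. u y * laplacian \<psi> y)"
    and super: "\<And>y b. y \<in> U \<Longrightarrow> b \<in> Basis \<Longrightarrow>
      ((\<lambda>t. (w (y + t *\<^sub>R b) + w (y - t *\<^sub>R b) - 2 * w y) / t\<^sup>2) \<longlongrightarrow> D b y) (at_right 0)"
    "\<And>y. y \<in> U \<Longrightarrow> (\<Sum>b\<in>Basis. D b y) \<le> k * w y"
  shows "u x \<le> w x"
proof (rule ccontr)
  assume "\<not> u x \<le> w x"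
  define m where "m = u x - w x"
  have m: "0 < m" using \<open>\<not> u x \<le> w x\<close> by (simp add: m_def)
  obtain R where R: "\<And>y. y \<in> K \<Longrightarrow> norm y \<le> R"
    using compact_imp_bounded[OF K(1)] by (auto simp: bounded_iff)
  have "uniformly_continuous_on (cball 0 (R + 1)) u"
    using continuous_on_subset[OF u] by (intro compact_uniformly_continuous) auto
  then have uc: "\<exists>d>0. \<forall>y\<in>cball 0 (R + 1). \<forall>z\<in>cball 0 (R + 1). dist z y < d \<longrightarrow> dist (u z) (u y) < e"
    if "0 < e" for e using that by (simp add: uniformly_continuous_on_def)
  obtain d1 where d1: "0 < d1" "\<And>y z. norm y \<le> R + 1 \<Longrightarrow> norm z \<le> R + 1 \<Longrightarrow> dist z y < d1 \<Longrightarrow>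
      \<bar>u z - u y\<bar> < m / 4"
    using uc[of "m / 4"] m by (auto simp: dist_real_def)
  have "uniformly_continuous_on K w" using w K(1) by (rule compact_uniformly_continuous)
  then obtain d2 where d2: "0 < d2" "\<And>y z. y \<in> K \<Longrightarrow> z \<in> K \<Longrightarrow> dist z y < d2 \<Longrightarrow> \<bar>w z - w y\<bar> < m / 4"
    using m unfolding uniformly_continuous_on_def dist_real_def
    by (metis divide_pos_pos zero_less_numeral)
  \<comment> \<open>A displacement by at most \<open>\<eta>\<close> changes \<open>u\<close> and
    \<open>w\<close> by less than m/4 each. The bound 1 keeps all arguments of \<open>u\<close>
    inside the ball of radius \<open>R + 1\<close>, where its uniform continuity is used.\<close>
  define \<eta> where "\<eta> = min 1 (min (d1 / 2) (d2 / 2))"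
  have \<eta>: "0 < \<eta>" "\<eta> \<le> 1" "\<eta> < d1" "\<eta> < d2" using d1(1) d2(1) by (auto simp: \<eta>_def min_def)
  obtain \<rho> :: "'a \<Rightarrow> real" where \<rho>: "test_function \<rho>" "\<And>z. 0 \<le> \<rho> z"
    "(LINT z|lborel. \<rho> z) = 1" "\<And>z. \<rho> z \<noteq> 0 \<Longrightarrow> norm z \<le> \<eta>"
    using ex_mollifier[OF \<eta>(1)] by blast
  \<comment> \<open>The mollification of \<open>u\<close>, with the reflected kernel. It is defined
    at every point because \<open>u\<close> is, so nothing has to be cut off near the boundary of
    \<open>K\<close>.\<close>
  define M where "M p = (LINT z|lborel. u (z + p) * \<rho> z)" for p
  have cu: "continuous_on UNIV (\<lambda>z. u (z + p))" for p
    using continuous_on_compose2[OF u, of UNIV "\<lambda>z. z + p"] by (simp add: continuous_on_add)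
  have i: "integrable lborel (\<lambda>z. u (z + p) * \<rho> z)" for p
    using integrable_test_function_mult[OF \<rho>(1) borel_measurable_continuous_onI[OF cu]
        bounded_image_cball_continuous[OF cu]] by (simp add: mult.commute)
  have i\<rho>: "integrable lborel \<rho>" by (rule integrable_test_function[OF \<rho>(1)])
  have M_near: "\<bar>M p - u p\<bar> \<le> m / 4" if "p \<in> K" for p
  proof -
    have "M p - u p = (LINT z|lborel. (u (z + p) - u p) * \<rho> z)"
      using i[of p] i\<rho> \<rho>(3) by (simp add: M_def left_diff_distrib)
    moreover have "\<bar>u (z + p) - u p\<bar> \<le> m / 4" if "\<rho> z \<noteq> 0" for z
    proof -
      have "norm z \<le> \<eta>" using \<rho>(4) that by simp
      moreover have "norm (z + p) \<le> norm z + norm p" by (rule norm_triangle_ineq)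
      ultimately show ?thesis
        using d1(2)[of p "z + p"] R[OF \<open>p \<in> K\<close>] \<eta> by (simp add: dist_norm)
    qed
    ultimately show ?thesis
      using mollifier_integral_bound[OF \<rho>(1,2,3) continuous_on_diff[OF cu[of p] continuous_on_const],
          of "u p" "m / 4"] by simp
  qed
  have "continuous_on K M"
    unfolding continuous_on_iff
  proof (intro ballI allI impI)
    fix p :: 'a and e :: real assume p: "p \<in> K" and e: "0 < e"
    from uc[of "e / 2"] e obtain d where d: "0 < d" "\<And>y z. norm y \<le> R + 1 \<Longrightarrow> norm z \<le> R + 1 \<Longrightarrow>
        dist z y < d \<Longrightarrow> \<bar>u z - u y\<bar> < e / 2" by (auto simp: dist_real_def)
    have "dist (M q) (M p) < e" if q: "q \<in> K" "dist q p < d" for q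
    proof -
      have "M q - M p = (LINT z|lborel. (u (z + q) - u (z + p)) * \<rho> z)"
        using i[of p] i[of q] by (simp add: M_def left_diff_distrib)
      moreover have "\<bar>u (z + q) - u (z + p)\<bar> \<le> e / 2" if "\<rho> z \<noteq> 0" for z
      proof -
        have "norm z \<le> 1" using \<rho>(4)[OF that] \<eta> by simp
        then show ?thesis
          using d(2)[of "z + p" "z + q"] R[OF p] R[OF q(1)] q(2)
            norm_triangle_ineq[of z p] norm_triangle_ineq[of z q] by (simp add: dist_norm)
      qed
      ultimately have "\<bar>M q - M p\<bar> \<le> e / 2"
        using mollifier_integral_bound[OF \<rho>(1,2,3) continuous_on_diff[OF cu[of q] cu[of p]],
            of "e / 2"] by simp
      then show ?thesis using e by (simp add: dist_real_def)
    qed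
    with d(1) show "\<exists>d>0. \<forall>q\<in>K. dist q p < d \<longrightarrow> dist (M q) (M p) < e" by blast
  qed
  then have "continuous_on K (\<lambda>p. M p - w p)" using w by (intro continuous_intros)
  then obtain p where p: "p \<in> K" "\<And>q. q \<in> K \<Longrightarrow> M q - w q \<le> M p - w p"
    using continuous_attains_sup[OF K(1)] x by blast
  have Mp: "3 * m / 4 \<le> M p - w p"
    using p(2)[OF x] abs_le_D2[OF M_near[OF x]] by (simp add: m_def field_simps)
  \<comment> \<open>Near the maximum the boundary inequality would fail: passing from M(p) - w(p)
    \<ge> 3m/4 to u(z) - w(z) costs at most m/4 for M(p) against u(p) and strictly less than m/4 for
    each of the moves of \<open>u\<close> and \<open>w\<close> from p to z, which leaves a positive
    value.\<close>
  have far: "z \<in> U" if "z \<in> K" "dist z p \<le> \<eta>" for z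
  proof (rule ccontr)
    assume "z \<notin> U"
    then have "u z \<le> w z" using bdry that by simp
    moreover have "\<bar>u z - u p\<bar> < m / 4" using d1(2)[of p z] R[OF p(1)] R[OF that(1)] that(2) \<eta> by simp
    moreover have "\<bar>w z - w p\<bar> < m / 4" using d2(2)[of p z] p(1) that \<eta> by simp
    ultimately show False
      using Mp M_near[OF p(1)] m by linarith
  qed
  \<comment> \<open>\<open>far\<close> speaks only of points of \<open>K\<close>, and the ball is
    not yet known to lie in \<open>K\<close>. If it left \<open>U\<close>, by connectedness it would
    meet the frontier of \<open>U\<close>, whose points belong to the closed set \<open>K\<close>
    but not to the open set \<open>U\<close>, against \<open>far\<close>.\<close>
  have sub_U: "cball p \<eta> \<subseteq> U"
  proof (rule ccontr)
    assume "\<not> cball p \<eta> \<subseteq> U"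
    moreover have "p \<in> cball p \<eta> \<inter> U" using far[OF p(1)] \<eta> by simp
    ultimately have "cball p \<eta> \<inter> frontier U \<noteq> {}"
      using connected_Int_frontier[OF convex_connected[OF convex_cball[of p \<eta>]], of U] by blast
    then obtain z where z: "dist z p \<le> \<eta>" "z \<in> frontier U" by (auto simp: dist_commute)
    have "closure U \<subseteq> K" using K by (intro closure_minimal compact_imp_closed)
    with z K(2) have "z \<in> K" "z \<notin> U" by (auto simp: frontier_def interior_open)
    with far z show False by blast
  qed
  define \<psi> where "\<psi> y = \<rho> (y - p)" for y
  have \<psi>: "test_function \<psi>" unfolding \<psi>_def[abs_def] by (rule test_function_translate[OF \<rho>(1)])
  \<comment> \<open>Shifts of \<open>M\<close> are thereby expressed through shifts of
    \<open>\<psi>\<close>, the test function that also enters the weak inequality.\<close>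
  have Mq: "M (p + h) = (LINT y|lborel. u y * \<psi> (y - h))" for h
  proof -
    have "(\<lambda>y. \<psi> (y - h)) \<in> borel_measurable borel"
      using test_function_translate[OF \<psi>] by simp
    with borel_measurable_continuous_onI[OF u]
    have "(\<lambda>y. u y * \<psi> (y - h)) \<in> borel_measurable borel" by simp
    from integral_translate[OF this, of "p + h"] show ?thesis
      by (simp add: M_def \<psi>_def)
  qed
  have "k * (LINT y|lborel. u y * \<psi> y) \<le> (LINT y|lborel. u y * laplacian \<psi> y)"
  proof (rule sub[OF \<psi>])
    show "0 \<le> \<psi> y" for y using \<rho>(2) by (simp add: \<psi>_def)
    show "\<psi> y = 0" if "y \<notin> U" for y
      using \<rho>(4)[of "y - p"] sub_U that
      by (auto simp: \<psi>_def dist_norm norm_minus_commute[of p] subset_iff)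
  qed
  then have kM: "k * M p \<le> (LINT y|lborel. u y * laplacian \<psi> y)" using Mq[of 0] by simp
  let ?t = unit_step
  \<comment> \<open>The second difference of M - w at its maximum \<open>p\<close>: nonpositive as
    soon as the step is below \<open>\<eta>\<close>, since both shifted points then lie in
    \<open>K\<close>.\<close>
  define S where "S b n = (M (p + ?t n *\<^sub>R b) + M (p - ?t n *\<^sub>R b) - 2 * M p) / (?t n)\<^sup>2 -
      (w (p + ?t n *\<^sub>R b) + w (p - ?t n *\<^sub>R b) - 2 * w p) / (?t n)\<^sup>2" for b n
  have pU: "p \<in> U" using sub_U \<eta> by auto
  have "(\<lambda>n. \<Sum>b\<in>Basis. S b n) \<longlonglongrightarrow> (\<Sum>b\<in>Basis. (LINT y|lborel. u y * pd b (pd b \<psi>) y) - D b p)"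
  proof (intro tendsto_sum)
    fix b :: 'a assume b: "b \<in> Basis"
    have "M p = (LINT y|lborel. u y * \<psi> y)"
      "M (p + ?t n *\<^sub>R b) = (LINT y|lborel. u y * \<psi> (y - ?t n *\<^sub>R b))"
      "M (p - ?t n *\<^sub>R b) = (LINT y|lborel. u y * \<psi> (y + ?t n *\<^sub>R b))" for n
      using Mq[of 0] Mq[of "?t n *\<^sub>R b"] Mq[of "- (?t n *\<^sub>R b)"] by simp_all
    with test_function_second_difference[OF u \<psi> b]
    have "(\<lambda>n. (M (p + ?t n *\<^sub>R b) + M (p - ?t n *\<^sub>R b) - 2 * M p) / (?t n)\<^sup>2) \<longlonglongrightarrow>
        (LINT y|lborel. u y * pd b (pd b \<psi>) y)" by (simp add: add.commute)
    then show "S b \<longlonglongrightarrow> (LINT y|lborel. u y * pd b (pd b \<psi>) y) - D b p"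
      unfolding S_def by (intro tendsto_diff filterlim_compose[OF super(1)[OF pU b] filterlim_unit_step])
  qed
  moreover have "\<forall>\<^sub>F n in sequentially. (\<Sum>b\<in>Basis. S b n) \<le> 0"
  proof -
    have "\<forall>\<^sub>F n in sequentially. ?t n < \<eta>"
      using filterlim_unit_step \<eta>(1) unfolding filterlim_at by (auto dest: order_tendstoD(2))
    then show ?thesis
    proof eventually_elim
      case (elim n)
      show ?case
      proof (rule sum_nonpos)
        fix b :: 'a assume b: "b \<in> Basis"
        have "p + ?t n *\<^sub>R b \<in> cball p \<eta>" "p - ?t n *\<^sub>R b \<in> cball p \<eta>"
          using elim b unit_step(1)[of n] by (simp_all add: dist_norm)
        then have "M (p + ?t n *\<^sub>R b) - w (p + ?t n *\<^sub>R b) \<le> M p - w p"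
          "M (p - ?t n *\<^sub>R b) - w (p - ?t n *\<^sub>R b) \<le> M p - w p"
          using sub_U K(3) by (blast intro: p(2))+
        then show "S b n \<le> 0"
          unfolding S_def diff_divide_distrib[symmetric]
          by (intro divide_nonpos_nonneg) simp_all
      qed
    qed
  qed
  ultimately have "(\<Sum>b\<in>Basis. (LINT y|lborel. u y * pd b (pd b \<psi>) y) - D b p) \<le> 0"
    by (rule tendsto_upperbound) simp
  moreover have "(\<Sum>b\<in>Basis. LINT y|lborel. u y * pd b (pd b \<psi>) y) = (LINT y|lborel. u y * laplacian \<psi> y)"
  proof -
    have "integrable lborel (\<lambda>y. u y * pd b (pd b \<psi>) y)" if "b \<in> Basis" for b
      using integrable_test_function_mult[OF test_function_pd[OF test_function_pd[OF \<psi> that] that]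
          borel_measurable_continuous_onI[OF u] bounded_image_cball_continuous[OF u]]
      by (simp add: mult.commute)
    then show ?thesis
      by (simp add: laplacian_def sum_distrib_left)
  qed
  \<comment> \<open>The chain is k M(p) \<le> Laplacian of M at p \<le> sum of the limits
    \<open>D b p\<close> \<le> k w(p), whereas M(p) - w(p) is at least 3m/4.\<close>
  ultimately have "k * M p \<le> k * w p"
    using kM super(2)[OF pU] by (simp add: sum_subtractf)
  then show False using k Mp m by simp
qed

section \<open>Radial comparison functions\<close>

text \<open>One family covers both barriers: s = 1 is smooth also at the centre \<open>x\<close>,
  while s = 0 gives the plain exponential of |y - x|, used away from the centre.\<close>

definition radial_exp :: "real \<Rightarrow> real \<Rightarrow> 'a::euclidean_space \<Rightarrow> 'a \<Rightarrow> real" where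
  "radial_exp a s x y = exp (a * sqrt (s + (norm (y - x))\<^sup>2))"

text \<open>The second derivative of exp(a g) along \<open>b\<close>, that is exp(a g) (a^2 g'^2 + a
  g'') for g(t) = sqrt(s + |y - x + t b|^2): at t = 0 one has g' = B / sqrt(A) and g'' = 1 / sqrt(A)
  - B^2 / A^(3/2).\<close>

definition radial_exp_D2 :: "real \<Rightarrow> real \<Rightarrow> 'a::euclidean_space \<Rightarrow> 'a \<Rightarrow> 'a \<Rightarrow> real" where
  "radial_exp_D2 a s x b y = (let A = s + (norm (y - x))\<^sup>2; B = (y - x) \<bullet> b in
     radial_exp a s x y * (a\<^sup>2 * B\<^sup>2 / A + a * (1 / sqrt A - B\<^sup>2 / (A * sqrt A))))"

lemma norm_add_scaleR_Basis:
  "b \<in> Basis \<Longrightarrow> (norm (v + t *\<^sub>R b))\<^sup>2 = (norm v)\<^sup>2 + 2 * (v \<bullet> b) * t + t\<^sup>2"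
  unfolding power2_norm_eq_inner
  by (simp add: inner_add_left inner_add_right inner_commute[of b v] power2_eq_square distrib_left)

lemma continuous_on_radial_exp: "continuous_on S (radial_exp a s x)"
  unfolding radial_exp_def[abs_def] by (intro continuous_intros)

lemma radial_exp_second_difference:
  fixes x y :: "'a::euclidean_space"
  assumes A: "0 < s + (norm (y - x))\<^sup>2" and b: "b \<in> Basis"
  shows "((\<lambda>t. (radial_exp a s x (y + t *\<^sub>R b) + radial_exp a s x (y - t *\<^sub>R b) -
      2 * radial_exp a s x y) / t\<^sup>2) \<longlongrightarrow> radial_exp_D2 a s x b y) (at_right 0)"
proof -
  define A where "A = s + (norm (y - x))\<^sup>2"
  define B where "B = (y - x) \<bullet> b"
  have A: "0 < A" using A by (simp add: A_def)
  define q where "q t = A + 2 * B * t + t\<^sup>2" for t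
  define f where "f t = exp (a * sqrt (q t))" for t
  define f' where "f' t = f t * (a * ((B + t) / sqrt (q t)))" for t
  have f: "radial_exp a s x (y + t *\<^sub>R b) = f t" for t
  proof -
    have "(norm (y + t *\<^sub>R b - x))\<^sup>2 = (norm ((y - x) + t *\<^sub>R b))\<^sup>2" by (simp add: algebra_simps)
    also have "\<dots> = (norm (y - x))\<^sup>2 + 2 * B * t + t\<^sup>2"
      unfolding B_def using b by (rule norm_add_scaleR_Basis)
    finally show ?thesis by (simp add: radial_exp_def f_def q_def A_def)
  qed
  have q: "(q has_real_derivative 2 * (B + t)) (at t)" for t
    unfolding q_def by (auto intro!: derivative_eq_intros)
  have sq: "((\<lambda>t. sqrt (q t)) has_real_derivative (B + t) / sqrt (q t)) (at t)" if "0 < q t" for t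
    using that by (auto intro!: derivative_eq_intros q simp: field_simps)
  have f1: "(f has_real_derivative f' t) (at t)" if "0 < q t" for t
    unfolding f_def[abs_def] f'_def
    by (rule DERIV_fun_exp[OF DERIV_cmult[OF sq[OF that]]])
  have q0: "q 0 = A" by (simp add: q_def)
  have "(f' has_real_derivative f 0 * (a\<^sup>2 * B\<^sup>2 / A + a * (1 / sqrt A - B\<^sup>2 / (A * sqrt A)))) (at 0)"
  proof -
    define r where "r = sqrt A"
    have r: "0 < r" "A = r * r" using A by (simp_all add: r_def)
    have "((\<lambda>t. (B + t) / sqrt (q t)) has_real_derivative
        (1 * sqrt (q 0) - (B + 0) * ((B + 0) / sqrt (q 0))) / (sqrt (q 0) * sqrt (q 0))) (at 0)"
      using A by (intro DERIV_divide sq) (auto simp: q0 intro!: derivative_eq_intros)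
    from DERIV_mult[OF f1 DERIV_cmult[OF this, of a]] A
    have "(f' has_real_derivative f' 0 * (a * (B / r)) +
        a * ((r - B * (B / r)) / (r * r)) * f 0) (at 0)"
      by (simp add: f'_def[abs_def] q0 r_def)
    moreover have "f' 0 * (a * (B / r)) + a * ((r - B * (B / r)) / (r * r)) * f 0 =
        f 0 * (a\<^sup>2 * B\<^sup>2 / A + a * (1 / sqrt A - B\<^sup>2 / (A * sqrt A)))"
      using r by (simp add: f'_def q0 flip: r_def) (simp add: field_simps power2_eq_square)
    ultimately show ?thesis by simp
  qed
  \<comment> \<open>For |t| < e the linear term satisfies |2 B t| < A, so the radicand stays
    positive; the summand 1 covers B = 0.\<close>
  moreover define e where "e = A / (2 * \<bar>B\<bar> + 1)"
  have e: "0 < e" using A by (simp add: e_def)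
  have "0 < q t" if "\<bar>t\<bar> < e" for t
  proof -
    have "2 * \<bar>B\<bar> * \<bar>t\<bar> \<le> (2 * \<bar>B\<bar>) * e" using that by (intro mult_left_mono) auto
    also have "\<dots> < (2 * \<bar>B\<bar> + 1) * e" using e by (simp add: algebra_simps)
    also have "\<dots> = A" by (simp add: e_def)
    finally have "\<bar>2 * B * t\<bar> < A" by (simp add: abs_mult)
    then show ?thesis using zero_le_power2[of t] unfolding q_def by linarith
  qed
  ultimately have "((\<lambda>t. (f t + f (- t) - 2 * f 0) / t\<^sup>2) \<longlongrightarrow>
      f 0 * (a\<^sup>2 * B\<^sup>2 / A + a * (1 / sqrt A - B\<^sup>2 / (A * sqrt A)))) (at_right 0)"
    by (intro second_difference_tendsto[OF e f1]) auto
  then show ?thesis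
    using f[of "- t" for t] f[of 0]
    by (simp add: f radial_exp_D2_def Let_def A_def[symmetric] B_def[symmetric])
qed

lemma sum_radial_exp_D2:
  fixes x y :: "'a::euclidean_space"
  defines "N \<equiv> (norm (y - x))\<^sup>2"
  shows "(\<Sum>b\<in>Basis. radial_exp_D2 a s x b y) = radial_exp a s x y *
    (a\<^sup>2 * N / (s + N) + a * (DIM('a) / sqrt (s + N) - N / ((s + N) * sqrt (s + N))))"
proof -
  have N: "(\<Sum>b\<in>Basis. ((y - x) \<bullet> b)\<^sup>2) = N"
    unfolding N_def power2_norm_eq_inner by (subst (2) euclidean_inner) (simp add: power2_eq_square)
  have "(\<Sum>b\<in>Basis. radial_exp_D2 a s x b y) = radial_exp a s x y *
    (\<Sum>b\<in>Basis. a\<^sup>2 * ((y - x) \<bullet> b)\<^sup>2 / (s + N) +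
      a * (1 / sqrt (s + N) - ((y - x) \<bullet> b)\<^sup>2 / ((s + N) * sqrt (s + N))))"
    by (simp add: radial_exp_D2_def Let_def N_def sum_distrib_left)
  also have "\<dots> = radial_exp a s x y *
    (a\<^sup>2 * N / (s + N) + a * (DIM('a) / sqrt (s + N) - N / ((s + N) * sqrt (s + N))))"
    by (simp add: sum.distrib sum_subtractf sum_distrib_left[symmetric] sum_divide_distrib[symmetric] N)
  finally show ?thesis .
qed

lemma affine_radial_exp_second_difference:
  fixes x y :: "'a::euclidean_space"
  assumes "0 < s + (norm (y - x))\<^sup>2" "b \<in> Basis"
  shows "((\<lambda>t. ((c * radial_exp a s x (y + t *\<^sub>R b) + d) + (c * radial_exp a s x (y - t *\<^sub>R b) + d) -
      2 * (c * radial_exp a s x y + d)) / t\<^sup>2) \<longlongrightarrow> c * radial_exp_D2 a s x b y) (at_right 0)"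
  using tendsto_mult_left[OF radial_exp_second_difference[OF assms], of c a]
  by (simp add: algebra_simps)

section \<open>The two barrier estimates\<close>

text \<open>On the ball \<open>\<phi>\<close> is a weak subsolution with constant m - \<mu>, and the
  Laplacian of the barrier is at most a^2 + a d times the barrier. Scaling by M exp(-a R) lifts the
  barrier above the bound \<open>M\<close> on the sphere, since sqrt(1 + R^2) \<ge> R; at the centre
  it equals M exp(a) exp(-a R).\<close>

lemma eigenfunction_upper:
  fixes \<phi> V :: "'a::euclidean_space \<Rightarrow> real" and a m R \<mu> :: real
  assumes \<phi>: "continuous_on UNIV \<phi>" "\<And>y. 0 < \<phi> y" "\<And>y. \<phi> y \<le> M"
    and V: "V \<in> borel_measurable borel" "\<And>R. bounded (V ` cball 0 R)"
    and eq: "\<And>\<psi>. test_function \<psi> \<Longrightarrow>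
      (LINT y|lborel. \<phi> y * laplacian \<psi> y) = (LINT y|lborel. (V y - \<mu>) * \<phi> y * \<psi> y)"
    and m: "\<And>y. y \<in> ball x R \<Longrightarrow> m \<le> V y"
    and R: "0 < R" and a: "0 < a" "a\<^sup>2 + a * DIM('a) \<le> m - \<mu>"
  shows "\<phi> x \<le> M * exp (a * (1 - R))"
proof -
  define c where "c = M * exp (- a * R)"
  define w where "w y = c * radial_exp a 1 x y + 0" for y
  have M: "0 < M" using \<phi>(2,3) less_le_trans by blast
  then have c: "0 < c" by (simp add: c_def)
  have k: "0 < m - \<mu>" using a by (meson add_pos_nonneg less_le_trans mult_nonneg_nonneg of_nat_0_le_iff order_less_imp_le zero_less_power)
  have "\<phi> x \<le> w x"
  proof (rule weak_comparison[OF \<phi>(1), where K="cball x R" and U="ball x R" and k="m - \<mu>"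
        and D="\<lambda>b y. c * radial_exp_D2 a 1 x b y"])
    show "continuous_on (cball x R) w"
      unfolding w_def by (intro continuous_intros continuous_on_radial_exp)
    show "\<phi> y \<le> w y" if "y \<in> cball x R - ball x R" for y
    proof -
      have y: "norm (y - x) = R" using that by (auto simp: dist_norm norm_minus_commute)
      have "R \<le> sqrt (1 + R\<^sup>2)" using R by (intro real_le_rsqrt) simp
      then have "exp (a * R) \<le> radial_exp a 1 x y"
        using a by (simp add: radial_exp_def y)
      then have "c * exp (a * R) \<le> w y" using c by (simp add: w_def)
      moreover have "c * exp (a * R) = M" by (simp add: c_def exp_minus)
      ultimately show ?thesis using \<phi>(3)[of y] by linarith
    qed
    fix \<psi> :: "'a \<Rightarrow> real"
    assume \<psi>: "test_function \<psi>" "\<And>y. 0 \<le> \<psi> y" "\<And>y. y \<notin> ball x R \<Longrightarrow> \<psi> y = 0"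
    have i: "integrable lborel (\<lambda>y. (V y - \<mu>) * \<phi> y * \<psi> y)"
      by (rule integrable_potential_mult_test[OF \<phi>(1) V \<psi>(1)])
    have "(m - \<mu>) * (LINT y|lborel. \<phi> y * \<psi> y) = (LINT y|lborel. (m - \<mu>) * (\<phi> y * \<psi> y))"
      by simp
    also have "\<dots> \<le> (LINT y|lborel. (V y - \<mu>) * \<phi> y * \<psi> y)"
    proof (rule integral_mono[OF _ i])
      show "integrable lborel (\<lambda>y. (m - \<mu>) * (\<phi> y * \<psi> y))"
        by (intro integrable_mult_right integrable_continuous_mult_test \<phi> \<psi>)
      show "(m - \<mu>) * (\<phi> y * \<psi> y) \<le> (V y - \<mu>) * \<phi> y * \<psi> y" for y
      proof (cases "y \<in> ball x R")
        case True
        then show ?thesis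
          using m[OF True] \<psi>(2)[of y] \<phi>(2)[of y] unfolding mult.assoc[of "V y - \<mu>"]
          by (intro mult_right_mono mult_nonneg_nonneg) simp_all
      qed (simp add: \<psi>(3))
    qed
    finally show "(m - \<mu>) * (LINT y|lborel. \<phi> y * \<psi> y) \<le> (LINT y|lborel. \<phi> y * laplacian \<psi> y)"
      using eq[OF \<psi>(1)] by simp
  next
    fix y b :: 'a assume "b \<in> Basis"
    then show "((\<lambda>t. (w (y + t *\<^sub>R b) + w (y - t *\<^sub>R b) - 2 * w y) / t\<^sup>2) \<longlongrightarrow>
        c * radial_exp_D2 a 1 x b y) (at_right 0)"
      unfolding w_def by (intro affine_radial_exp_second_difference) (auto simp: add_pos_nonneg)
  next
    fix y :: 'a
    define N where "N = (norm (y - x))\<^sup>2"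
    have N: "0 \<le> N" by (simp add: N_def)
    have "a\<^sup>2 * N / (1 + N) \<le> a\<^sup>2"
      using N by (simp add: field_simps)
    moreover have "a * (DIM('a) / sqrt (1 + N) - N / ((1 + N) * sqrt (1 + N))) \<le> a * DIM('a)"
    proof (intro mult_left_mono)
      have "DIM('a) / sqrt (1 + N) \<le> DIM('a) / 1" using N by (intro divide_left_mono) simp_all
      moreover have "0 \<le> N / ((1 + N) * sqrt (1 + N))" using N by simp
      ultimately show "DIM('a) / sqrt (1 + N) - N / ((1 + N) * sqrt (1 + N)) \<le> real DIM('a)" by simp
    qed (use a in simp)
    ultimately have le: "a\<^sup>2 * N / (1 + N) + a * (DIM('a) / sqrt (1 + N) - N / ((1 + N) * sqrt (1 + N)))
        \<le> m - \<mu>" using a by linarith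
    have "(\<Sum>b\<in>Basis. radial_exp_D2 a 1 x b y) \<le> radial_exp a 1 x y * (m - \<mu>)"
      unfolding sum_radial_exp_D2 N_def[symmetric]
      by (rule mult_left_mono[OF le]) (simp add: radial_exp_def)
    then show "(\<Sum>b\<in>Basis. c * radial_exp_D2 a 1 x b y) \<le> (m - \<mu>) * w y"
      using c by (simp add: sum_distrib_left[symmetric] w_def mult_ac)
  qed (use R k in auto)
  also have "w x = M * exp (a * (1 - R))"
    by (simp add: w_def c_def radial_exp_def right_diff_distrib exp_diff exp_minus field_simps)
  finally show ?thesis .
qed

text \<open>The comparison is applied to \<open>- \<phi>\<close>, turning the supersolution into a
  subsolution. On the unit sphere the barrier exp(-a |y|) - exp(-a R) is at most 1, so
  \<open>c\<close> suffices there; on the outer sphere it is 0. The constant \<open>k\<close> is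
  kept apart from m - \<mu> because the comparison needs it positive.\<close>

lemma eigenfunction_lower:
  fixes \<phi> V :: "'a::euclidean_space \<Rightarrow> real" and a m R \<mu> :: real
  assumes \<phi>: "continuous_on UNIV \<phi>" "\<And>y. 0 < \<phi> y" "\<And>y. norm y = 1 \<Longrightarrow> c \<le> \<phi> y"
    and V: "V \<in> borel_measurable borel" "\<And>R. bounded (V ` cball 0 R)"
    and eq: "\<And>\<psi>. test_function \<psi> \<Longrightarrow>
      (LINT y|lborel. \<phi> y * laplacian \<psi> y) = (LINT y|lborel. (V y - \<mu>) * \<phi> y * \<psi> y)"
    and m: "\<And>y. norm y < R \<Longrightarrow> V y \<le> m"
    and x: "1 \<le> norm x" "norm x \<le> R" and c: "0 < c"
    and a: "0 < a" and k: "0 < k" "m - \<mu> \<le> k" "k \<le> a\<^sup>2 - a * DIM('a)"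
  shows "c * (exp (- a * norm x) - exp (- a * R)) \<le> \<phi> x"
proof -
  define w where "w y = (- c) * radial_exp (- a) 0 0 y + c * exp (- a * R)" for y :: 'a
  have w: "w y = - c * (exp (- a * norm y) - exp (- a * R))" for y
    by (simp add: w_def radial_exp_def algebra_simps)
  have "- \<phi> x \<le> w x"
  proof (rule weak_comparison[where u="\<lambda>y. - \<phi> y" and K="cball 0 R - ball 0 1" and U="ball 0 R - cball 0 1"
        and k=k and D="\<lambda>b y. (- c) * radial_exp_D2 (- a) 0 0 b y"])
    show "continuous_on UNIV (\<lambda>y. - \<phi> y)" using \<phi>(1) by (intro continuous_intros)
    show "continuous_on (cball 0 R - ball 0 1) w"
      unfolding w_def by (intro continuous_intros continuous_on_radial_exp)
    show "compact (cball (0::'a) R - ball 0 1)" by (intro compact_diff) auto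
    show "- \<phi> y \<le> w y" if y: "y \<in> (cball 0 R - ball 0 1) - (ball 0 R - cball 0 1)" for y
    proof (cases "norm y = 1")
      case True
      have "exp (- a) \<le> 1" "0 < exp (- a * R)" using a by simp_all
      then have "exp (- a * norm y) - exp (- a * R) \<le> 1"
        unfolding True mult_1_right by linarith
      then have "c * (exp (- a * norm y) - exp (- a * R)) \<le> c * 1"
        using c True by (intro mult_left_mono) simp_all
      then show ?thesis using \<phi>(3)[OF True] by (simp add: w)
    next
      case False
      then have "norm y = R" using y by auto
      then show ?thesis using \<phi>(2)[of y] by (simp add: w)
    qed
    fix \<psi> :: "'a \<Rightarrow> real"
    assume \<psi>: "test_function \<psi>" "\<And>y. 0 \<le> \<psi> y" "\<And>y. y \<notin> ball 0 R - cball 0 1 \<Longrightarrow> \<psi> y = 0"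
    have i: "integrable lborel (\<lambda>y. (V y - \<mu>) * \<phi> y * \<psi> y)"
      by (rule integrable_potential_mult_test[OF \<phi>(1) V \<psi>(1)])
    have "(LINT y|lborel. (V y - \<mu>) * \<phi> y * \<psi> y) \<le> (LINT y|lborel. k * (\<phi> y * \<psi> y))"
    proof (rule integral_mono[OF i])
      show "integrable lborel (\<lambda>y. k * (\<phi> y * \<psi> y))"
        by (intro integrable_mult_right integrable_continuous_mult_test \<phi> \<psi>)
      show "(V y - \<mu>) * \<phi> y * \<psi> y \<le> k * (\<phi> y * \<psi> y)" for y
      proof (cases "y \<in> ball 0 R")
        case True
        then show ?thesis
          using m[of y] k(2) \<psi>(2)[of y] \<phi>(2)[of y] unfolding mult.assoc[of "V y - \<mu>"]
          by (intro mult_right_mono mult_nonneg_nonneg) simp_all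
      qed (simp add: \<psi>(3))
    qed
    also have "\<dots> = k * (LINT y|lborel. \<phi> y * \<psi> y)" by simp
    finally show "k * (LINT y|lborel. - \<phi> y * \<psi> y) \<le> (LINT y|lborel. - \<phi> y * laplacian \<psi> y)"
      using eq[OF \<psi>(1)] by simp
  next
    fix y b :: 'a assume y: "y \<in> ball 0 R - cball 0 1" and "b \<in> Basis"
    moreover have "y \<noteq> 0" using y by (metis Diff_iff centre_in_cball zero_le_one)
    ultimately show "((\<lambda>t. (w (y + t *\<^sub>R b) + w (y - t *\<^sub>R b) - 2 * w y) / t\<^sup>2) \<longlongrightarrow>
        (- c) * radial_exp_D2 (- a) 0 0 b y) (at_right 0)"
      unfolding w_def by (intro affine_radial_exp_second_difference) auto
  next
    fix y :: 'a assume y: "y \<in> ball 0 R - cball 0 1"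
    define E where "E = exp (- a * norm y)"
    have n: "1 < norm y" using y by simp
    then have "y \<noteq> 0" by (metis norm_zero not_one_less_zero)
    have "(\<Sum>b\<in>Basis. radial_exp_D2 (- a) 0 0 b y) = E * (a\<^sup>2 - a * (DIM('a) / norm y - 1 / norm y))"
      unfolding sum_radial_exp_D2 using \<open>y \<noteq> 0\<close> by (simp add: radial_exp_def E_def)
    also have "\<dots> \<ge> E * k"
    proof (rule mult_left_mono)
      have "DIM('a) / norm y \<le> DIM('a) / 1" using n \<open>y \<noteq> 0\<close> by (intro divide_left_mono) simp_all
      moreover have "0 \<le> 1 / norm y" by simp
      ultimately have "DIM('a) / norm y - 1 / norm y \<le> DIM('a)" by linarith
      then have "a * (DIM('a) / norm y - 1 / norm y) \<le> a * DIM('a)" using a by (intro mult_left_mono) simp_all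
      then show "k \<le> a\<^sup>2 - a * (DIM('a) / norm y - 1 / norm y)" using k(3) by linarith
    qed (simp add: E_def)
    finally have "c * (E * k) \<le> c * (\<Sum>b\<in>Basis. radial_exp_D2 (- a) 0 0 b y)" using c by simp
    \<comment> \<open>The additive shift contributes nothing to the second differences, but raises k
      w by exactly this amount, which is the favourable direction.\<close>
    moreover have "0 \<le> k * (c * exp (- a * R))" using k c by simp
    ultimately show "(\<Sum>b\<in>Basis. (- c) * radial_exp_D2 (- a) 0 0 b y) \<le> k * w y"
      by (simp add: sum_distrib_left[symmetric] sum_negf w E_def algebra_simps)
  qed (use x k in auto)
  then show ?thesis by (simp add: w)
qed

section \<open>Decay of the ground state\<close>

lemma confining_ge:
  assumes "confining V"
  obtains r where "0 < r" "\<And>x. r \<le> norm x \<Longrightarrow> T \<le> V (x::'a::euclidean_space)"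
proof -
  have "\<forall>\<^sub>F x in at_infinity. T \<le> V x"
    using assms unfolding confining_def filterlim_at_top by blast
  then obtain b where "\<And>x. b \<le> norm x \<Longrightarrow> T \<le> V x"
    by (auto simp: eventually_at_infinity)
  then show thesis by (intro that[of "max 1 b"]) auto
qed

lemma locally_bounded_cball: "locally_bounded V \<Longrightarrow> bounded (V ` cball x R)"
  by (simp add: locally_bounded_def)

text \<open>A real supremum bounds its set only if the set is bounded above; local boundedness on
  the enclosing closed ball supplies this.\<close>

lemma V_upper_ge:
  assumes "locally_bounded V" "norm z < norm x + \<delta>"
  shows "V z \<le> V_upper V \<delta> x"
proof -
  have "bounded (V ` ball 0 (norm x + \<delta>))"
    using locally_bounded_cball[OF assms(1), of 0 "norm x + \<delta>"]
    by (rule bounded_subset) auto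
  then show ?thesis
    unfolding V_upper_def using assms(2)
    by (intro cSUP_upper bounded_imp_bdd_above) auto
qed

lemma V_lower_le:
  assumes "\<And>x. 0 \<le> V x" "z \<in> ball x (\<delta> * norm x)"
  shows "V_lower V \<delta> x \<le> V z"
  unfolding V_lower_def using assms by (intro cINF_lower bdd_belowI[of _ 0]) auto

text \<open>By the triangle inequality every point of the ball has norm at least (1 - \<delta>) |x|,
  so confinement carries over from \<open>V\<close> to the infimum.\<close>

lemma V_lower_ge:
  assumes "0 < \<delta>" "\<delta> < 1" "0 < norm x" "\<And>z. (1 - \<delta>) * norm x \<le> norm z \<Longrightarrow> T \<le> V z"
  shows "T \<le> V_lower V \<delta> x"
  unfolding V_lower_def
proof (rule cINF_greatest)
  show "ball x (\<delta> * norm x) \<noteq> {}" using mult_pos_pos[OF assms(1,3)] by (simp add: not_le)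
  fix z assume "z \<in> ball x (\<delta> * norm x)"
  then have "norm (x - z) < \<delta> * norm x" by (simp add: dist_norm)
  moreover have "norm x \<le> norm (x - z) + norm z" using norm_triangle_ineq[of "x - z" z] by simp
  ultimately show "T \<le> V z" by (intro assms(4)) (simp add: algebra_simps)
qed

section \<open>Choice of the rate and of the radius in the two bounds\<close>

context
  fixes V \<phi> :: "'a::euclidean_space \<Rightarrow> real" and \<mu> :: real
  assumes V: "V \<in> borel_measurable borel" "\<And>x. 0 \<le> V x" "locally_bounded V" "confining V"
    and \<phi>: "continuous_on UNIV \<phi>" "\<And>y. 0 < \<phi> y" "bounded (range \<phi>)"
    and eq: "\<And>\<psi>. test_function \<psi> \<Longrightarrow>
      (LINT y|lborel. \<phi> y * laplacian \<psi> y) = (LINT y|lborel. (V y - \<mu>) * \<phi> y * \<psi> y)"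
begin

lemma ground_state_lower:
  assumes \<epsilon>: "0 < \<epsilon>" and \<delta>: "0 < \<delta>"
  shows "\<exists>c r. 0 < c \<and> 0 < r \<and> (\<forall>x. r \<le> norm x \<longrightarrow>
    c * exp (- (1 + \<epsilon>) * sqrt (V_upper V \<delta> x) * norm x) \<le> \<phi> x)"
proof -
  \<comment> \<open>A lower bound for q = sqrt(V^\<delta>(x)), one summand per use: q \<ge> 1 gives
    |\<mu>| \<le> q |\<mu>|; q \<ge> 1/\<delta> gives a \<delta> \<ge> 1; and the last summand makes
    the gain 2 \<epsilon> q^2 in a^2 absorb both the first-order term (1 + \<epsilon>) q d and
    |\<mu>|.\<close>
  define Q where "Q = 1 + 1 / \<delta> + ((1 + \<epsilon>) * DIM('a) + \<bar>\<mu>\<bar>) / (2 * \<epsilon>)"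
  have Q: "1 \<le> Q" "1 / \<delta> \<le> Q" "((1 + \<epsilon>) * DIM('a) + \<bar>\<mu>\<bar>) / (2 * \<epsilon>) \<le> Q"
    using \<epsilon> \<delta> by (simp_all add: Q_def)
  obtain r where r: "0 < r" "\<And>x. r \<le> norm x \<Longrightarrow> Q\<^sup>2 \<le> V x"
    using confining_ge[OF V(4)] by blast
  have "sphere (0::'a) 1 \<noteq> {}" by simp
  then obtain y0 where y0: "y0 \<in> sphere (0::'a) 1" "\<And>y. y \<in> sphere 0 1 \<Longrightarrow> \<phi> y0 \<le> \<phi> y"
    using continuous_attains_inf[OF compact_sphere _ continuous_on_subset[OF \<phi>(1) subset_UNIV]] by blast
  define c where "c = \<phi> y0"
  have c: "0 < c" using \<phi>(2) by (simp add: c_def)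
  have "c / 2 * exp (- (1 + \<epsilon>) * sqrt (V_upper V \<delta> x) * norm x) \<le> \<phi> x" if x: "max 1 r \<le> norm x" for x
  proof -
    define m where "m = V_upper V \<delta> x"
    define q where "q = sqrt m"
    define a where "a = (1 + \<epsilon>) * q"
    have "Q\<^sup>2 \<le> m" using r(2)[of x] V_upper_ge[OF V(3), of x x \<delta>] \<delta> x by (simp add: m_def)
    then have qQ: "Q \<le> q" using Q(1) by (simp add: q_def real_le_rsqrt)
    then have q: "1 \<le> q" "1 / \<delta> \<le> q" "((1 + \<epsilon>) * DIM('a) + \<bar>\<mu>\<bar>) / (2 * \<epsilon>) \<le> q" using Q by linarith+
    have m: "m = q\<^sup>2" using \<open>Q\<^sup>2 \<le> m\<close> by (simp add: q_def order_trans[OF zero_le_power2])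
    have aq: "q \<le> a" using \<epsilon> q(1) by (simp add: a_def)
    have "q * ((1 + \<epsilon>) * DIM('a) + \<bar>\<mu>\<bar>) \<le> q * (2 * \<epsilon> * q)"
      using q(1,3) \<epsilon> by (intro mult_left_mono) (simp_all add: field_simps)
    moreover have "\<bar>\<mu>\<bar> \<le> q * \<bar>\<mu>\<bar>" using q(1) mult_right_mono[of 1 q "\<bar>\<mu>\<bar>"] by simp
    moreover have "a\<^sup>2 - a * DIM('a) = m + q * (2 * \<epsilon> * q) + (\<epsilon> * q)\<^sup>2 - q * ((1 + \<epsilon>) * DIM('a))"
      by (simp add: a_def m power2_eq_square algebra_simps)
    ultimately have k: "m + \<bar>\<mu>\<bar> \<le> a\<^sup>2 - a * DIM('a)"
      using zero_le_power2[of "\<epsilon> * q"] unfolding distrib_left[of q] by linarith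
    have "1 \<le> m" using q(1) by (simp add: m)
    \<comment> \<open>The comparison constant is m + |\<mu>|, which is positive and dominates m -
      \<mu> whatever the sign of \<mu>.\<close>
    have L: "c * (exp (- a * norm x) - exp (- a * (norm x + \<delta>))) \<le> \<phi> x"
    proof (rule eigenfunction_lower[OF \<phi>(1,2) _ V(1) locally_bounded_cball[OF V(3)] eq _ _ _ c])
      show "c \<le> \<phi> y" if "norm y = 1" for y using y0(2)[of y] that by (simp add: c_def)
      show "V y \<le> m" if "norm y < norm x + \<delta>" for y using V_upper_ge[OF V(3) that] by (simp add: m_def)
      show "0 < m + \<bar>\<mu>\<bar>" using \<open>1 \<le> m\<close> by simp
      show "0 < a" using aq q(1) by simp
    qed (use x \<delta> k in auto)
    have "1 \<le> a * \<delta>" using q(2) aq \<delta> by (simp add: field_simps) (meson mult_left_mono less_imp_le order_trans)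
    then have "exp (- a * \<delta>) \<le> exp (- 1)" by simp
    also have "exp (- 1) \<le> (1/2 :: real)" using exp_ge_add_one_self[of 1] by (simp add: exp_minus field_simps)
    finally have "exp (- a * \<delta>) \<le> 1 / 2" .
    then have "c * exp (- a * norm x) * (1 / 2) \<le> c * exp (- a * norm x) * (1 - exp (- a * \<delta>))"
      using c by (intro mult_left_mono) simp_all
    also have "\<dots> = c * (exp (- a * norm x) - exp (- a * (norm x + \<delta>)))"
      by (simp add: algebra_simps exp_add[symmetric] flip: exp_add)
    finally have "c / 2 * exp (- a * norm x) \<le> \<phi> x" using L by simp
    moreover have "- a * norm x = - (1 + \<epsilon>) * sqrt (V_upper V \<delta> x) * norm x"
      by (simp add: a_def q_def m_def algebra_simps)
    ultimately show ?thesis by (simp only:)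
  qed
  then show ?thesis using c r(1) by (intro exI[of _ "c / 2"] exI[of _ "max 1 r"]) auto
qed

lemma ground_state_upper:
  assumes \<epsilon>: "0 < \<epsilon>" "\<epsilon> < 1" and \<delta>: "0 < \<delta>" "\<delta> < 1"
  shows "\<exists>c r. 0 < c \<and> 0 < r \<and> (\<forall>x. r \<le> norm x \<longrightarrow>
    \<phi> x \<le> c * exp (- (1 - \<epsilon>) * \<delta> * sqrt (V_lower V \<delta> x) * norm x))"
proof -
  \<comment> \<open>For q = sqrt(V_\<delta>(x)) above this value, (\<epsilon>/2) q^2 exceeds q d +
    |\<mu>|, the first-order term and the eigenvalue.\<close>
  define Q where "Q = 1 + 2 * (DIM('a) + \<bar>\<mu>\<bar>) / \<epsilon>"
  have Q: "1 \<le> Q" "2 * (DIM('a) + \<bar>\<mu>\<bar>) / \<epsilon> \<le> Q" using \<epsilon> by (simp_all add: Q_def)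
  obtain r where r: "0 < r" "\<And>x. r \<le> norm x \<Longrightarrow> Q\<^sup>2 \<le> V x"
    using confining_ge[OF V(4)] by blast
  obtain M where M: "\<And>y. \<phi> y \<le> M"
    using \<phi>(3) by (auto simp: bounded_iff abs_le_iff)
  then have "0 < M" using \<phi>(2) less_le_trans by blast
  \<comment> \<open>The first entry keeps the ball around x in the region where V \<ge> Q^2; the
    second gives \<epsilon> R \<ge> 2 for R = \<delta> |x|.\<close>
  define r0 where "r0 = max (r / (1 - \<delta>)) (2 / (\<epsilon> * \<delta>))"
  have "0 < r0" using r(1) \<delta> by (simp add: r0_def less_max_iff_disj)
  have "\<phi> x \<le> M * exp (- (1 - \<epsilon>) * \<delta> * sqrt (V_lower V \<delta> x) * norm x)" if x: "r0 \<le> norm x" for x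
  proof -
    define m where "m = V_lower V \<delta> x"
    define q where "q = sqrt m"
    \<comment> \<open>The loss \<epsilon> is split in two: one half is spent in the differential
      inequality, the other pays for the factor exp(a) of the regularised barrier.\<close>
    define a where "a = (1 - \<epsilon> / 2) * q"
    define R where "R = \<delta> * norm x"
    have nx: "0 < norm x" using x \<open>0 < r0\<close> by linarith
    have xr: "r \<le> (1 - \<delta>) * norm x" using x \<delta> by (simp add: r0_def field_simps)
    have Rge: "2 \<le> \<epsilon> * R" using x \<delta> \<epsilon> by (simp add: r0_def R_def field_simps)
    have R: "0 < R" using nx \<delta> by (simp add: R_def)
    have "Q\<^sup>2 \<le> m" unfolding m_def
      using xr by (intro V_lower_ge \<delta> nx r(2)) simp
    then have qQ: "Q \<le> q" using Q(1) by (simp add: q_def real_le_rsqrt)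
    then have q: "1 \<le> q" "2 * (DIM('a) + \<bar>\<mu>\<bar>) / \<epsilon> \<le> q" using Q by linarith+
    have m: "m = q\<^sup>2" using \<open>Q\<^sup>2 \<le> m\<close> by (simp add: q_def order_trans[OF zero_le_power2])
    have "q * (DIM('a) + \<bar>\<mu>\<bar>) \<le> q * (\<epsilon> / 2 * q)"
      using q \<epsilon> by (intro mult_left_mono) (simp_all add: field_simps)
    moreover have "\<bar>\<mu>\<bar> \<le> q * \<bar>\<mu>\<bar>" using q(1) mult_right_mono[of 1 q "\<bar>\<mu>\<bar>"] by simp
    moreover have "a * DIM('a) \<le> q * DIM('a)"
      using \<epsilon> q(1) by (intro mult_right_mono) (simp_all add: a_def)
    moreover have "a\<^sup>2 \<le> (1 - \<epsilon> / 2) * q\<^sup>2"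
    proof -
      have "a\<^sup>2 = (1 - \<epsilon> / 2) * ((1 - \<epsilon> / 2) * q\<^sup>2)" by (simp add: a_def power2_eq_square)
      also have "\<dots> \<le> (1 - \<epsilon> / 2) * (1 * q\<^sup>2)"
        using \<epsilon> by (intro mult_left_mono mult_right_mono) simp_all
      finally show ?thesis by simp
    qed
    moreover have "(1 - \<epsilon> / 2) * q\<^sup>2 = q\<^sup>2 - q * (\<epsilon> / 2 * q)"
      by (simp add: power2_eq_square algebra_simps)
    ultimately have k: "a\<^sup>2 + a * DIM('a) \<le> m - \<mu>"
      using abs_ge_self[of \<mu>] unfolding m distrib_left[of q] by linarith
    have U: "\<phi> x \<le> M * exp (a * (1 - R))"
    proof (rule eigenfunction_upper[OF \<phi>(1,2) M V(1) locally_bounded_cball[OF V(3)] eq _ R])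
      show "m \<le> V y" if "y \<in> ball x R" for y
        using V_lower_le[OF V(2), of y x \<delta>] that by (simp add: m_def R_def)
      show "0 < a" using \<epsilon> q(1) by (simp add: a_def)
    qed (use k in simp_all)
    \<comment> \<open>Equivalent to 1 - \<epsilon>/2 \<le> \<epsilon> R / 2, hence the requirement
      \<epsilon> R \<ge> 2.\<close>
    have "(1 - \<epsilon> / 2) * (1 - R) \<le> - (1 - \<epsilon>) * R" using Rge \<epsilon> by (simp add: field_simps)
    then have "q * ((1 - \<epsilon> / 2) * (1 - R)) \<le> q * (- (1 - \<epsilon>) * R)"
      using q(1) by (intro mult_left_mono) simp_all
    then have "a * (1 - R) \<le> - (1 - \<epsilon>) * \<delta> * sqrt (V_lower V \<delta> x) * norm x"
      by (simp add: a_def R_def q_def m_def mult_ac)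
    then have "M * exp (a * (1 - R)) \<le> M * exp (- (1 - \<epsilon>) * \<delta> * sqrt (V_lower V \<delta> x) * norm x)"
      using \<open>0 < M\<close> by simp
    with U show ?thesis by linarith
  qed
  then show ?thesis using \<open>0 < M\<close> \<open>0 < r0\<close> by blast
qed

end

theorem theorem1p1:
  fixes V \<phi> :: "'a::euclidean_space \<Rightarrow> real"
  assumes "V \<in> borel_measurable borel"
    and "\<And>x. 0 \<le> V x"
    and "locally_bounded V"
    and "confining V"
    and "ground_state V \<phi>"
  shows "(\<forall>\<epsilon> \<delta>. 0 < \<epsilon> \<and> 0 < \<delta> \<and> \<delta> < 1 \<longrightarrow>
           (\<exists>c r. 0 < c \<and> 0 < r \<and> (\<forall>x. r \<le> norm x \<longrightarrow>
              c * exp (- (1 + \<epsilon>) * sqrt (V_upper V \<delta> x) * norm x) \<le> \<phi> x))) \<and>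
         (\<forall>\<epsilon> \<delta>. 0 < \<epsilon> \<and> \<epsilon> < 1 \<and> 0 < \<delta> \<and> \<delta> < 1 \<longrightarrow>
           (\<exists>c r. 0 < c \<and> 0 < r \<and> (\<forall>x. r \<le> norm x \<longrightarrow>
              \<phi> x \<le> c * exp (- (1 - \<epsilon>) * \<delta> * sqrt (V_lower V \<delta> x) * norm x))))"
proof -
  have \<phi>: "continuous_on UNIV \<phi>" "\<And>y. 0 < \<phi> y" "bounded (range \<phi>)"
    using assms(5) by (auto simp: ground_state_def)
  have eq: "(LINT y|lborel. \<phi> y * laplacian \<psi> y) = (LINT y|lborel. (V y - ground_energy V) * \<phi> y * \<psi> y)"
    if "test_function \<psi>" for \<psi>
    using assms(5) that
    by (intro eigenfunction_weak_equation assms(1) locally_bounded_cball[OF assms(3)] \<phi>(1))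
      (simp_all add: ground_state_def)
  show ?thesis
    using ground_state_lower[OF assms(1-4) \<phi> eq] ground_state_upper[OF assms(1-4) \<phi> eq] by blast
qed

end
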